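(* Let $(X,\tau,\mathsf d)$ be an extended metric-topological space, let $I$ be a directed set and assume that the nets $(\mu_i)_{i\in I}$, $(\nu_i)_{i\in I}$ in $\mathcal P(X)$ weakly converge to $\mu,\nu\in\mathcal P(X)$ respectively. Then, for any choice of $\boldsymbol\pi_i\in\Gamma(\mu_i,\nu_i)$, one has: (a) the net $(\boldsymbol\pi_i)_{i\in I}$ has limit points with respect to weak convergence and any limit point $\boldsymbol\pi$ belongs to $\Gamma(\mu,\nu)$; (b) if $\boldsymbol\pi_i$ weakly converges to $\boldsymbol\pi$, and $\mathsf c_i:X\times X\to[0,\infty]$, $i\in I$, is a monotone (nondecreasing in $i$) family of $(\tau\times\tau)$-lower semicontinuous functions, then $$\liminf_{i\in I}\int\mathsf c_i\,d\boldsymbol\pi_i\ge\int\mathsf c\,d\boldsymbol\pi\qquad\text{with }\mathsf c:=\sup_i\mathsf c_i;$$ (c) if $\mu_i=\mu$, $\nu_i=\nu$ for all $i$, and if $\mathsf d_i:X\times X\to[0,\infty]$, $i\in I$, is a monotone (nondecreasing in $i$) family of $(\tau\times\tau)$-continuous distances with $\lim_i\mathsf d_i=\mathsf d$, then $W_{\mathsf d_i}(\mu,\nu)$ monotonically converges to $W_{\mathsf d}(\mu,\nu)$.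
   Context: An extended metric space $(X,\mathsf d)$ is a set with a symmetric $\mathsf d:X\times X\to[0,\infty]$ satisfying the triangle inequality and $\mathsf d(x,y)=0$ iff $x=y$; for a semidistance the last condition is weakened to $\mathsf d(x,x)=0$. For a Hausdorff topology $\tau$ on $X$, $\mathrm{Lip}_b(X,\tau,\mathsf d)$ is the set of bounded, $\mathsf d$-Lipschitz, $\tau$-continuous functions $f:X\to\mathbb R$. $(X,\tau,\mathsf d)$ is an extended metric-topological space if (a) there are $(\tau\times\tau)$-continuous bounded semidistances $\mathsf d_i:X\times X\to[0,\infty)$, $i\in I$, with $\mathsf d=\sup_i\mathsf d_i$; (b) $\tau$ is generated by $\mathrm{Lip}_b(X,\tau,\mathsf d)$. $\mathcal P(X)$ is the set of Radon probability measures on the Borel sets of $\tau$ (for every Borel $B$ and $\epsilon>0$ there is a compact $K\subset B$ with $\mu(B\setminus K)<\epsilon$); similarly $\mathcal P(X\times X)$ for $\tau\times\tau$. Weak convergence is convergence in duality with bounded continuous functions. $\Gamma(\mu,\nu)\subset\mathcal P(X\times X)$ is the set of Radon probability measures with first marginal $\mu$ and second marginal $\nu$. $W_{\mathsf d}^2(\mu,\nu)=\inf\{\int\mathsf d^2\,d\boldsymbol\pi:\boldsymbol\pi\in\Gamma(\mu,\nu)\}$, and $W_{\mathsf d_i}$ is defined in the same way with $\mathsf d_i$ in place of $\mathsf d$. *)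

theory Defs
  imports "HOL-Probability.Probability"
begin

definition directed_set :: "'i set \<Rightarrow> ('i \<Rightarrow> 'i \<Rightarrow> bool) \<Rightarrow> bool" where
  "directed_set I le \<longleftrightarrow>
     I \<noteq> {} \<and> reflp_on I le \<and> transp_on I le \<and>
     (\<forall>i\<in>I. \<forall>j\<in>I. \<exists>k\<in>I. le i k \<and> le j k)"

definition net_filter :: "'i set \<Rightarrow> ('i \<Rightarrow> 'i \<Rightarrow> bool) \<Rightarrow> 'i filter" where
  "net_filter I le = (INF i\<in>I. principal {j \<in> I. le i j})"

lemma eventually_net_filter:
  assumes "directed_set I le"
  shows "eventually P (net_filter I le) \<longleftrightarrow> (\<exists>i\<in>I. \<forall>j\<in>I. le i j \<longrightarrow> P j)"
  unfolding net_filter_def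
proof (subst eventually_INF_base)
  show "I \<noteq> {}" using assms by (simp add: directed_set_def)
next
  fix a b assume ab: "a \<in> I" "b \<in> I"
  then obtain k where k: "k \<in> I" "le a k" "le b k"
    using assms unfolding directed_set_def by blast
  have "le a j \<and> le b j" if "j \<in> I" "le k j" for j
    using assms ab k that unfolding directed_set_def by (meson transp_onD)
  with k(1) show "\<exists>x\<in>I. principal {j \<in> I. le x j}
                  \<le> inf (principal {j \<in> I. le a j}) (principal {j \<in> I. le b j})"
    by (intro bexI[of _ k]) auto
qed (auto simp: eventually_principal)

lemma frequently_net_filter:
  assumes "directed_set I le"
  shows "frequently P (net_filter I le) \<longleftrightarrow> (\<forall>i\<in>I. \<exists>j\<in>I. le i j \<and> P j)"
  using assms by (auto simp: frequently_def eventually_net_filter)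

definition extended_distance :: "('a \<Rightarrow> 'a \<Rightarrow> ennreal) \<Rightarrow> bool" where
  "extended_distance d \<longleftrightarrow>
     (\<forall>x y. d x y = d y x) \<and> (\<forall>x y z. d x z \<le> d x y + d y z) \<and> (\<forall>x y. d x y = 0 \<longleftrightarrow> x = y)"

definition finite_semidistance :: "('a \<Rightarrow> 'a \<Rightarrow> real) \<Rightarrow> bool" where
  "finite_semidistance \<delta> \<longleftrightarrow>
     (\<forall>x y. 0 \<le> \<delta> x y) \<and> (\<forall>x y. \<delta> x y = \<delta> y x) \<and>
     (\<forall>x y z. \<delta> x z \<le> \<delta> x y + \<delta> y z) \<and> (\<forall>x. \<delta> x x = 0)"

definition Lip_b :: "('a::topological_space \<Rightarrow> 'a \<Rightarrow> ennreal) \<Rightarrow> ('a \<Rightarrow> real) set" where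
  "Lip_b d = {f \<in> bcontfun. \<exists>L\<ge>0. \<forall>x y. ennreal \<bar>f x - f y\<bar> \<le> ennreal L * d x y}"

text \<open>The space is the whole type, and \<open>\<tau>\<close> is its type class topology; the Hausdorff
  property is part of the class.\<close>

definition extended_metric_topological_space :: "('a::t2_space \<Rightarrow> 'a \<Rightarrow> ennreal) \<Rightarrow> bool" where
  "extended_metric_topological_space d \<longleftrightarrow>
     extended_distance d \<and>
     (\<exists>D. (\<forall>\<delta>\<in>D. finite_semidistance \<delta> \<and> (\<lambda>(x, y). \<delta> x y) \<in> bcontfun) \<and>
          (\<forall>x y. d x y = (SUP \<delta>\<in>D. ennreal (\<delta> x y)))) \<and>
     (open :: 'a set \<Rightarrow> bool) = generate_topology {f -` V | f V. f \<in> Lip_b d \<and> open V}"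

definition radon_probs :: "'a::t2_space measure set" where
  "radon_probs =
     {M. prob_space M \<and> sets M = sets borel \<and>
         (\<forall>B\<in>sets borel. \<forall>e>0. \<exists>K. compact K \<and> K \<subseteq> B \<and> measure M (B - K) < e)}"

definition weakly_converges ::
  "('i \<Rightarrow> 'a::t2_space measure) \<Rightarrow> 'a measure \<Rightarrow> 'i filter \<Rightarrow> bool" where
  "weakly_converges M N F \<longleftrightarrow>
     (\<forall>f :: 'a \<Rightarrow> real. f \<in> bcontfun \<longrightarrow>
        ((\<lambda>i. \<integral>x. f x \<partial>M i) \<longlongrightarrow> (\<integral>x. f x \<partial>N)) F)"

definition weak_topology :: "'a::t2_space measure topology" where
  "weak_topology = topology_generated_by
     {{M \<in> radon_probs. (\<integral>x. f x \<partial>M) \<in> V} | (f :: 'a \<Rightarrow> real) V. f \<in> bcontfun \<and> open V}"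

lemma topspace_weak_topology:
  "topspace (weak_topology :: 'a::t2_space measure topology) = radon_probs"
proof -
  let ?S = "{{M \<in> radon_probs. (\<integral>x. f x \<partial>M) \<in> V} | (f :: 'a \<Rightarrow> real) V. f \<in> bcontfun \<and> open V}"
  have "(\<lambda>x :: 'a. 0 :: real) \<in> bcontfun"
    by (rule const_bcontfun)
  then have "radon_probs \<in> ?S"
    by (intro CollectI exI[of _ "\<lambda>x :: 'a. 0 :: real"] exI[of _ UNIV] conjI open_UNIV) simp_all
  then have "\<Union> ?S = radon_probs"
    by (intro equalityI Union_upper) auto
  then show ?thesis
    unfolding weak_topology_def topology_generated_by_topspace .
qed

lemma limitin_weak_topology_iff:
  fixes M :: "'i \<Rightarrow> 'a::t2_space measure"
  assumes M: "\<forall>\<^sub>F i in F. M i \<in> radon_probs" and N: "N \<in> radon_probs"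
  shows "limitin weak_topology M N F \<longleftrightarrow> weakly_converges M N F"
proof
  assume lim: "limitin weak_topology M N F"
  show "weakly_converges M N F"
    unfolding weakly_converges_def
  proof (intro allI impI topological_tendstoI)
    fix f :: "'a \<Rightarrow> real" and V
    assume f: "f \<in> bcontfun" and V: "open V" "(\<integral>x. f x \<partial>N) \<in> V"
    let ?U = "{M \<in> radon_probs. (\<integral>x. f x \<partial>M) \<in> V}"
    have "openin weak_topology ?U"
      unfolding weak_topology_def using f V by (intro topology_generated_by_Basis) auto
    then have "\<forall>\<^sub>F i in F. M i \<in> ?U"
      using lim V N by (auto simp: limitin_def)
    then show "\<forall>\<^sub>F i in F. (\<integral>x. f x \<partial>M i) \<in> V"
      by (rule eventually_mono) auto
  qed
next
  assume conv: "weakly_converges M N F"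
  have "\<forall>\<^sub>F i in F. M i \<in> U" if "openin weak_topology U" "N \<in> U" for U
  proof -
    have "generate_topology_on
            {{M \<in> radon_probs. (\<integral>x. f x \<partial>M) \<in> V} | (f :: 'a \<Rightarrow> real) V. f \<in> bcontfun \<and> open V} U"
      using that(1) by (simp add: weak_topology_def openin_topology_generated_by_iff)
    then show ?thesis using that(2)
    proof (induction rule: generate_topology_on.induct)
      case (UN K)
      then obtain k where k: "k \<in> K" "N \<in> k" by auto
      with UN have "\<forall>\<^sub>F i in F. M i \<in> k" by blast
      then show ?case by (rule eventually_mono) (use k in auto)
    next
      case (Basis s)
      then obtain f :: "'a \<Rightarrow> real" and V where
        s: "s = {M \<in> radon_probs. (\<integral>x. f x \<partial>M) \<in> V}" "f \<in> bcontfun" "open V" by auto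
      with Basis conv have "\<forall>\<^sub>F i in F. (\<integral>x. f x \<partial>M i) \<in> V"
        unfolding weakly_converges_def by (auto dest: topological_tendstoD)
      with M show ?case by eventually_elim (simp add: s)
    qed (auto intro: eventually_conj)
  qed
  then show "limitin weak_topology M N F"
    using N by (simp add: limitin_def topspace_weak_topology)
qed

definition net_limit_point :: "'b topology \<Rightarrow> ('i \<Rightarrow> 'b) \<Rightarrow> 'i filter \<Rightarrow> 'b \<Rightarrow> bool" where
  "net_limit_point T f F x \<longleftrightarrow>
     x \<in> topspace T \<and> (\<forall>U. openin T U \<and> x \<in> U \<longrightarrow> (\<exists>\<^sub>F i in F. f i \<in> U))"

text \<open>Here \<open>borel\<close> on the product type is the Borel \<open>\<sigma>\<close>-algebra of the product topology,
  which in general is larger than the product of the Borel \<open>\<sigma>\<close>-algebras.\<close>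

definition couplings :: "'a::t2_space measure \<Rightarrow> 'a measure \<Rightarrow> ('a \<times> 'a) measure set" where
  "couplings \<mu> \<nu> = {\<pi> \<in> radon_probs. distr \<pi> borel fst = \<mu> \<and> distr \<pi> borel snd = \<nu>}"

definition lower_semicontinuous :: "('b::topological_space \<Rightarrow> ennreal) \<Rightarrow> bool" where
  "lower_semicontinuous f \<longleftrightarrow> (\<forall>a. open {x. a < f x})"

definition ennreal_sqrt :: "ennreal \<Rightarrow> ennreal" where
  "ennreal_sqrt x = (if x = \<infinity> then \<infinity> else ennreal (sqrt (enn2real x)))"

definition wasserstein ::
  "('a::t2_space \<Rightarrow> 'a \<Rightarrow> ennreal) \<Rightarrow> 'a measure \<Rightarrow> 'a measure \<Rightarrow> ennreal" where
  "wasserstein d \<mu> \<nu> =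
     ennreal_sqrt (INF \<pi>\<in>couplings \<mu> \<nu>. \<integral>\<^sup>+(x, y). (d x y)\<^sup>2 \<partial>\<pi>)"

end

theory Submission
  imports Defs "HOL-Real_Asymp.Real_Asymp"
begin

text \<open>
  Since \<open>Lip\<^sub>b\<close> generates \<open>\<tau>\<close>, the topologies \<open>\<tau>\<close> and \<open>\<tau> \<times> \<tau>\<close> are completely regular.

  Weakly convergent nets of Radon measures need not be tight, so limit points are found on the level
  of functionals. By Tychonoff's theorem the functionals \<open>f \<mapsto> \<integral>f d\<pi>\<^sub>i\<close> on bounded continuous functions
  cluster at some positive functional \<open>L\<close>. If \<open>0 \<le> f \<le> 1\<close> vanishes on \<open>K \<times> H\<close>, then
  \<open>f(x, y) \<le> \<epsilon> + (1 - \<phi> x) + (1 - \<psi> y)\<close> with cutoff functions \<open>\<phi>\<close>, \<open>\<psi>\<close> of \<open>K\<close>, \<open>H\<close>, and the integral of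
  the right-hand side only sees the marginals; hence \<open>L\<close> inherits tightness from the limits \<open>\<mu>\<close>, \<open>\<nu>\<close>.
  A tight positive functional is integration against a Radon measure, which is the limit point.
  Its marginals are identified by testing with bounded continuous functions of one variable.

  For part (b), the integral of \<open>c = sup c\<^sub>i\<close> is approximated by finite sums of measures of the open sets
  \<open>{c > t}\<close>, the directed unions of \<open>{c\<^sub>i > t}\<close>. Compact subsets of these lie in a single
  \<open>{c\<^sub>j > t}\<close>, which yields a bounded continuous function below \<open>c\<^sub>j\<close> with almost the same integral.
  Part (c) follows from (a) and (b) for nearly optimal plans for \<open>d\<^sub>i\<close>.
\<close>

section \<open>Completely regular spaces\<close>

text \<open>Induction over the generated topology. On the preimage of \<open>V\<close> under
  \<open>f\<close>, the function \<open>\<bar>f y - f x\<bar> / e\<close> separates. An intersection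
  is handled by a maximum, which preserves \<open>g y \<ge> 1\<close> off the set but not equality
  with 1; truncation by \<open>min 1\<close> restores equality at the end.\<close>

lemma completely_regular_space_generated:
  fixes S :: "('a::t2_space \<Rightarrow> real) set"
  assumes gen: "(open :: 'a set \<Rightarrow> bool) = generate_topology {f -` V | f V. f \<in> S \<and> open V}"
    and cont: "\<And>f. f \<in> S \<Longrightarrow> continuous_on UNIV f"
  shows "completely_regular_space (euclidean :: 'a topology)"
proof -
  have *: "\<exists>g :: 'a \<Rightarrow> real. continuous_on UNIV g \<and> g x = 0 \<and> (\<forall>y. y \<notin> U \<longrightarrow> g y \<ge> 1)"
    if "open U" "x \<in> U" for U and x :: 'a
  proof -
    have "generate_topology {f -` V | f V. f \<in> S \<and> open V} U"
      using that(1) gen by simp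
    then show ?thesis
      using that(2)
    proof induction
      case UNIV
      show ?case by (rule exI[of _ "\<lambda>_. 0"]) auto
    next
      case (Int A B)
      then obtain f :: "'a \<Rightarrow> real" where
        f: "continuous_on UNIV f" "f x = 0" "\<forall>y. y \<notin> A \<longrightarrow> f y \<ge> 1"
        by auto
      from Int obtain g :: "'a \<Rightarrow> real" where
        g: "continuous_on UNIV g" "g x = 0" "\<forall>y. y \<notin> B \<longrightarrow> g y \<ge> 1"
        by auto
      from f g show ?case
        by (intro exI[of _ "\<lambda>y. max (f y) (g y)"] conjI continuous_intros)
           (auto simp: le_max_iff_disj)
    next
      case (UN K)
      then obtain V where V: "V \<in> K" "x \<in> V" by auto
      with UN.IH obtain g :: "'a \<Rightarrow> real"
        where "continuous_on UNIV g" "g x = 0" "\<forall>y. y \<notin> V \<longrightarrow> g y \<ge> 1"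
        by blast
      with V show ?case by (intro exI[of _ g]) auto
    next
      case (Basis U)
      then obtain f V where f: "f \<in> S" "open V" "U = f -` V" by auto
      then obtain e where e: "0 < e" "ball (f x) e \<subseteq> V"
        using Basis(2) by (auto simp: open_contains_ball)
      have "1 \<le> \<bar>f y - f x\<bar> / e" if "y \<notin> U" for y
        using that e f by (force simp: dist_real_def subset_iff field_simps)
      then show ?case
        using cont[OF f(1)] e(1)
        by (intro exI[of _ "\<lambda>y. \<bar>f y - f x\<bar> / e"] conjI continuous_intros) auto
    qed
  qed
  have **: "\<exists>g :: 'a \<Rightarrow> real. continuous_on UNIV g \<and> g x = 0 \<and> (\<forall>y. y \<notin> U \<longrightarrow> g y = 1)"
    if "open U" "x \<in> U" for U x
  proof -
    from that obtain g :: "'a \<Rightarrow> real"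
      where "continuous_on UNIV g" "g x = 0" "\<forall>y. y \<notin> U \<longrightarrow> g y \<ge> 1"
      using *[of U x] by blast
    then show ?thesis
      by (intro exI[of _ "\<lambda>y. min 1 (g y)"] conjI continuous_intros) auto
  qed
  show ?thesis
    unfolding completely_regular_space_alt'
    by (auto simp: image_subset_iff dest!: **)
qed

lemma completely_regular_space_euclidean_prod:
  assumes "completely_regular_space (euclidean :: 'a::t2_space topology)"
    and "completely_regular_space (euclidean :: 'b::t2_space topology)"
  shows "completely_regular_space (euclidean :: ('a \<times> 'b) topology)"
  using assms completely_regular_space_prod_topology[of "euclidean :: 'a topology" "euclidean :: 'b topology"]
  by simp

text \<open>Complete regularity separates points from closed sets, and compactness of
  \<open>K\<close> extends this to \<open>K\<close> and \<open>- U\<close>. These cutoffs mediate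
  between compact and open sets throughout.\<close>

lemma Urysohn_bcontfun:
  fixes K U :: "'a::t2_space set"
  assumes "completely_regular_space (euclidean :: 'a topology)" "compact K" "open U" "K \<subseteq> U"
  obtains f :: "'a \<Rightarrow> real" where "f \<in> bcontfun" "\<And>x. 0 \<le> f x" "\<And>x. f x \<le> 1"
    "\<And>x. x \<in> K \<Longrightarrow> f x = 1" "\<And>x. x \<notin> U \<Longrightarrow> f x = 0"
proof -
  have "disjnt K (- U)" using assms(4) by (auto simp: disjnt_iff)
  then obtain f where f: "continuous_map euclidean (top_of_set {0..1::real}) f"
    "f ` K \<subseteq> {1}" "f ` (- U) \<subseteq> {0}"
    using Urysohn_completely_regular_compact_closed[OF zero_le_one assms(1), of K "- U"] assms(2,3)
    by (metis closed_Compl closed_closedin compactin_euclidean_iff)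
  then have c: "continuous_on UNIV f" and r: "f x \<in> {0..1}" for x
    by (auto simp: continuous_map_in_subtopology)
  show thesis
  proof (rule that[of f])
    show "f \<in> bcontfun"
      using r by (intro bcontfun_normI[where b = 1] c) auto
  qed (use f r in auto)
qed

lemma bcontfunI_real:
  fixes f :: "'a::topological_space \<Rightarrow> real"
  assumes "continuous_on UNIV f" "\<And>x. 0 \<le> f x" "\<And>x. f x \<le> b"
  shows "f \<in> bcontfun"
  using assms by (intro bcontfun_normI[where b = b]) auto

lemma bcontfun_continuous: "f \<in> bcontfun \<Longrightarrow> continuous_on UNIV f"
  by (simp add: bcontfun_def)

lemma bcontfun_scale: "f \<in> bcontfun \<Longrightarrow> (\<lambda>x. r * f x) \<in> bcontfun"
  for f :: "'a::topological_space \<Rightarrow> real"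
  using scaleR_cont[of f r] by simp

lemma bcontfun_sum:
  fixes f :: "'i \<Rightarrow> 'a::topological_space \<Rightarrow> real"
  shows "(\<And>i. i \<in> A \<Longrightarrow> f i \<in> bcontfun) \<Longrightarrow> (\<lambda>x. \<Sum>i\<in>A. f i x) \<in> bcontfun"
  by (induction A rule: infinite_finite_induct) (auto intro: const_bcontfun plus_cont)

lemma integrable_bcontfun:
  fixes f :: "'a::topological_space \<Rightarrow> real"
  assumes "finite_measure M" "sets M = sets borel" "f \<in> bcontfun"
  shows "integrable M f"
proof -
  obtain b where b: "\<And>x. norm (f x) \<le> b"
    using assms(3) unfolding bcontfun_def bounded_iff by auto
  have "f \<in> borel_measurable M"
    using borel_measurable_continuous_onI[OF bcontfun_continuous[OF assms(3)]] assms(2)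
    by (simp cong: measurable_cong_sets)
  with b show ?thesis
    by (intro finite_measure.integrable_const_bound[OF assms(1), where B = b]) auto
qed

text \<open>The naturals below \<open>t\<close> form an initial segment with
  \<open>\<lceil>t\<rceil>\<close> elements, whatever \<open>N\<close> is. This serves to compare a
  sum of indicators of the level sets of \<open>f\<close> with \<open>n * f + 1\<close>.\<close>

lemma count_nat_less_le:
  assumes "0 \<le> t"
  shows "(\<Sum>k<N::nat. of_bool (real k < t)) \<le> t + 1"
proof (induction N)
  case (Suc N)
  show ?case
  proof (cases "real N < t")
    case True
    have "(\<Sum>k<Suc N. of_bool (real k < t)) \<le> (\<Sum>k<Suc N. 1 :: real)"
      by (intro sum_mono) auto
    with True show ?thesis by simp
  qed (use Suc in simp)
qed (use assms in simp)

section \<open>Riesz representation of tight functionals\<close>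

text \<open>The condition \<open>tight\<close> is the source of countable additivity: up to
  \<open>e\<close>, the functional sees functions only through a compact set. On a compact space it
  holds trivially with \<open>K = UNIV\<close>, and the setting is that of the Riesz-Markov
  theorem.\<close>

locale tight_functional =
  fixes L :: "('a::t2_space \<Rightarrow> real) \<Rightarrow> real"
  assumes completely_regular: "completely_regular_space (euclidean :: 'a topology)"
    and add: "f \<in> bcontfun \<Longrightarrow> g \<in> bcontfun \<Longrightarrow> L (\<lambda>x. f x + g x) = L f + L g"
    and scale: "f \<in> bcontfun \<Longrightarrow> L (\<lambda>x. r * f x) = r * L f"
    and nonneg: "f \<in> bcontfun \<Longrightarrow> (\<And>x. 0 \<le> f x) \<Longrightarrow> 0 \<le> L f"
    and one: "L (\<lambda>_. 1) = 1"
    and tight: "0 < e \<Longrightarrow> \<exists>K. compact K \<and>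
      (\<forall>f\<in>bcontfun. (\<forall>x. 0 \<le> f x \<and> f x \<le> 1) \<longrightarrow> (\<forall>x\<in>K. f x = 0) \<longrightarrow> L f \<le> e)"
begin

lemma const: "L (\<lambda>_. c) = c"
  using scale[of "\<lambda>_. 1" c] one by (simp add: const_bcontfun)

lemma diff: "f \<in> bcontfun \<Longrightarrow> g \<in> bcontfun \<Longrightarrow> L (\<lambda>x. f x - g x) = L f - L g"
  using add[of f "\<lambda>x. - 1 * g x"] scale[of g "- 1"] bcontfun_scale[of g "- 1"] by simp

lemma mono:
  assumes "f \<in> bcontfun" "g \<in> bcontfun" "\<And>x. f x \<le> g x"
  shows "L f \<le> L g"
  using nonneg[of "\<lambda>x. g x - f x"] diff[of g f] assms by (auto intro: minus_cont)

lemma sum: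
  assumes "\<And>i. i \<in> A \<Longrightarrow> f i \<in> bcontfun"
  shows "L (\<lambda>x. \<Sum>i\<in>A. f i x) = (\<Sum>i\<in>A. L (f i))"
  using assms
  by (induction A rule: infinite_finite_induct) (auto simp: const add bcontfun_sum)

section \<open>The content of open sets and its outer measure\<close>

text \<open>The analogue of the class of functions subordinate to \<open>U\<close> in the Riesz
  construction, with vanishing off \<open>U\<close> in place of compact support inside
  \<open>U\<close>. Tightness makes up for the missing compactness.\<close>

definition subordinate :: "'a set \<Rightarrow> ('a \<Rightarrow> real) set" where
  "subordinate U = {f \<in> bcontfun. (\<forall>x. 0 \<le> f x \<and> f x \<le> 1) \<and> (\<forall>x. x \<notin> U \<longrightarrow> f x = 0)}"

definition open_content :: "'a set \<Rightarrow> ennreal" where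
  "open_content U = (SUP f\<in>subordinate U. ennreal (L f))"

definition outer_content :: "'a set \<Rightarrow> ennreal" where
  "outer_content A = (INF U\<in>{U. open U \<and> A \<subseteq> U}. open_content U)"

lemma subordinate_zero: "(\<lambda>_. 0) \<in> subordinate U"
  by (auto simp: subordinate_def const_bcontfun)

lemma open_content_upper: "f \<in> subordinate U \<Longrightarrow> ennreal (L f) \<le> open_content U"
  unfolding open_content_def by (rule SUP_upper)

lemma subordinate_L:
  assumes "f \<in> subordinate U"
  shows "0 \<le> L f" "L f \<le> 1"
  using assms nonneg[of f] mono[of f "\<lambda>_. 1"] by (auto simp: subordinate_def one const_bcontfun)

lemma open_content_mono: "U \<subseteq> V \<Longrightarrow> open_content U \<le> open_content V"
  unfolding open_content_def by (intro SUP_subset_mono) (auto simp: subordinate_def)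

lemma open_content_le_1: "open_content U \<le> 1"
  unfolding open_content_def by (intro SUP_least) (auto dest: subordinate_L)

lemma open_content_empty: "open_content {} = 0"
proof -
  have "f = (\<lambda>_. 0)" if "f \<in> subordinate {}" for f
    using that by (auto simp: subordinate_def)
  then have "subordinate {} = {\<lambda>_. 0}"
    using subordinate_zero by blast
  then show ?thesis by (simp add: open_content_def const)
qed

lemma open_content_UNIV: "open_content UNIV = 1"
proof (rule antisym)
  have "(\<lambda>_. 1) \<in> subordinate UNIV"
    by (auto simp: subordinate_def const_bcontfun)
  from open_content_upper[OF this] show "1 \<le> open_content UNIV"
    by (simp add: one)
qed (rule open_content_le_1)

lemma open_content_approx:
  assumes "0 < e"
  obtains f where "f \<in> subordinate U" "open_content U \<le> ennreal (L f + e)"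
proof -
  have "open_content U \<le> 1" by (rule open_content_le_1)
  then have fin: "open_content U \<noteq> \<top>" by (auto simp: top_unique)
  have "\<exists>f\<in>subordinate U. open_content U < ennreal (L f) + ennreal e"
    using assms fin subordinate_zero[of U]
    by (intro SUP_approx_ennreal[OF _ _ open_content_def]) auto
  then obtain f where "f \<in> subordinate U" "open_content U < ennreal (L f) + ennreal e" by blast
  then show thesis
    using assms subordinate_L[of f U] by (intro that[of f]) (auto simp: ennreal_plus)
qed

lemma outer_content_open: "open U \<Longrightarrow> outer_content U = open_content U"
  unfolding outer_content_def
  by (intro antisym INF_lower INF_greatest) (auto intro: open_content_mono)

lemma outer_content_mono: "A \<subseteq> B \<Longrightarrow> outer_content A \<le> outer_content B"
  unfolding outer_content_def by (intro INF_superset_mono) auto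

lemma outer_content_approx:
  assumes "0 < e"
  obtains U where "open U" "A \<subseteq> U" "open_content U \<le> outer_content A + ennreal e"
proof -
  have "outer_content A \<le> open_content UNIV"
    unfolding outer_content_def by (rule INF_lower) auto
  then have "outer_content A \<noteq> \<top>"
    by (auto simp: open_content_UNIV top_unique)
  then have "\<exists>U\<in>{U. open U \<and> A \<subseteq> U}. open_content U < outer_content A + ennreal e"
    using assms
    by (intro INF_approx_ennreal[OF _ outer_content_def]) auto
  then show thesis using that by (auto dest: less_imp_le)
qed

text \<open>Tightness reduces the countable open cover to a finite one, up to a small remainder.\<close>

lemma open_content_countable_subadditive:
  assumes "\<And>n. open (U n)"
  shows "open_content (\<Union>n::nat. U n) \<le> (\<Sum>n. open_content (U n))"
  unfolding open_content_def[of "\<Union>n. U n"]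
proof (rule SUP_least, rule ennreal_le_epsilon)
  fix f and e :: real
  assume f: "f \<in> subordinate (\<Union>n. U n)" and e: "0 < e"
  then have fb: "f \<in> bcontfun" and f01: "\<And>x. 0 \<le> f x" "\<And>x. f x \<le> 1"
    and f0: "\<And>x. x \<notin> (\<Union>n. U n) \<Longrightarrow> f x = 0"
    unfolding subordinate_def by blast+
  define h where "h = e / 2"
  have h: "0 < h" using e by (simp add: h_def)
  obtain K where K: "compact K"
    "\<forall>f\<in>bcontfun. (\<forall>x. 0 \<le> f x \<and> f x \<le> 1) \<longrightarrow> (\<forall>x\<in>K. f x = 0) \<longrightarrow> L f \<le> h"
    using tight[OF h] by (elim exE conjE)
  \<comment> \<open>Off \<open>C\<close>, either \<open>f < h\<close> or the point lies outside
    \<open>K\<close>; both cost at most \<open>h\<close> under \<open>L\<close>. On \<open>C\<close>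
    the function \<open>f\<close> is positive, so the sets \<open>U n\<close> cover this compact
    set.\<close>
  define C where "C = K \<inter> {x. h \<le> f x}"
  have "closed {x. h \<le> f x}"
    using bcontfun_continuous[OF fb] by (intro closed_Collect_le continuous_intros)
  then have C: "compact C" unfolding C_def using K(1) by (rule compact_Int_closed[rotated])
  have "\<exists>n g. g \<in> subordinate (U n) \<and> g x = 1"
    if "x \<in> C" for x
  proof -
    from that h have "f x \<noteq> 0" by (auto simp: C_def)
    then obtain n where n: "x \<in> U n" using f0 by blast
    obtain g :: "'a \<Rightarrow> real" where "g \<in> bcontfun" "\<And>x. 0 \<le> g x" "\<And>x. g x \<le> 1"
      "\<And>y. y \<in> {x} \<Longrightarrow> g y = 1" "\<And>x. x \<notin> U n \<Longrightarrow> g x = 0"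
      by (rule Urysohn_bcontfun[OF completely_regular, of "{x}" "U n"]) (use n assms in auto)
    then show ?thesis by (intro exI[of _ n] exI[of _ g]) (simp add: subordinate_def)
  qed
  then obtain n g where g: "\<And>x. x \<in> C \<Longrightarrow> g x \<in> subordinate (U (n x))" "\<And>x. x \<in> C \<Longrightarrow> g x x = 1"
    by metis
  have ng: "g x \<in> bcontfun" "0 \<le> g x y" "g x y \<le> 1" "g x x = 1" "y \<notin> U (n x) \<Longrightarrow> g x y = 0"
    if "x \<in> C" for x y
    using g[OF that] by (simp_all add: subordinate_def)
  have "\<exists>D\<subseteq>C. finite D \<and> C \<subseteq> (\<Union>x\<in>D. {y. 1 / 2 < g x y})"
  proof (rule compactE_image[OF C])
    show "open {y. 1 / 2 < g x y}" if "x \<in> C" for x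
      using bcontfun_continuous[OF ng(1)[OF that]] by (intro open_Collect_less continuous_intros)
    show "C \<subseteq> (\<Union>x\<in>C. {y. 1 / 2 < g x y})"
      using ng(4) by force
  qed blast
  then obtain D where D: "D \<subseteq> C" "finite D" "C \<subseteq> (\<Union>x\<in>D. {y. 1 / 2 < g x y})" by blast
  \<comment> \<open>Peak functions attached to the same \<open>U m\<close> are merged into one
    function subordinate to \<open>U m\<close>. The factor 2 makes the sum at least 1 wherever some
    \<open>g x\<close> exceeds 1 / 2, and \<open>min 1\<close> keeps it in the unit
    interval.\<close>
  define G where "G m y = min 1 (\<Sum>x\<in>{x\<in>D. n x = m}. 2 * g x y)" for m y
  define N where "N = n ` D"
  have finN: "finite N" using D by (simp add: N_def)
  have Gs: "G m \<in> subordinate (U m)" for m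
    unfolding subordinate_def
  proof (intro CollectI conjI allI impI)
    have "continuous_on UNIV (G m)"
      unfolding G_def using D(1) by (intro continuous_intros bcontfun_continuous ng) auto
    moreover show nn: "0 \<le> G m x" for x
      unfolding G_def using D(1) ng(2) by (auto intro!: sum_nonneg)
    moreover show le: "G m x \<le> 1" for x
      unfolding G_def by simp
    ultimately show "G m \<in> bcontfun" by (rule bcontfunI_real)
    show "G m y = 0" if "y \<notin> U m" for y
    proof -
      have "(\<Sum>x\<in>{x\<in>D. n x = m}. 2 * g x y) = 0"
        using D(1) ng(5) that by (intro sum.neutral) auto
      then show ?thesis by (simp add: G_def)
    qed
  qed
  then have Gb: "G m \<in> bcontfun" and G01: "0 \<le> G m x" "G m x \<le> 1" for m x
    by (auto simp: subordinate_def)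
  \<comment> \<open>What remains of \<open>f\<close> after removing \<open>h\<close> and all
    \<open>G m\<close>. It vanishes on \<open>K\<close>: where \<open>f < h\<close> trivially, and
    on \<open>C\<close> because some \<open>G m\<close> equals 1 there. Tightness therefore bounds
    \<open>L r\<close> by \<open>h\<close>.\<close>
  define r where "r y = max 0 (f y - h - (\<Sum>m\<in>N. G m y))" for y
  have r01: "0 \<le> r y" "r y \<le> 1" for y
    using f01(2)[of y] h sum_nonneg[of N "\<lambda>m. G m y"] G01 by (auto simp: r_def)
  have rb: "r \<in> bcontfun"
  proof (rule bcontfunI_real[OF _ r01])
    show "continuous_on UNIV r"
      unfolding r_def by (intro continuous_intros bcontfun_continuous fb Gb)
  qed
  have "r y = 0" if y: "y \<in> K" for y
  proof (cases "h \<le> f y")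
    case True
    then have "y \<in> C" using y by (simp add: C_def)
    then obtain x where x: "x \<in> D" "1 / 2 < g x y" using D(3) by auto
    have "2 * g x y \<le> (\<Sum>z\<in>{z\<in>D. n z = n x}. 2 * g z y)"
      using x D ng(2) by (intro member_le_sum) auto
    then have "1 \<le> G (n x) y" using x by (simp add: G_def)
    also have "\<dots> \<le> (\<Sum>m\<in>N. G m y)"
      using x finN G01 by (intro member_le_sum) (auto simp: N_def)
    finally show ?thesis using f01(2)[of y] h by (simp add: r_def)
  next
    case False
    then show ?thesis using sum_nonneg[of N "\<lambda>m. G m y"] G01 by (simp add: r_def)
  qed
  then have Lr: "L r \<le> h" using bspec[OF K(2) rb] r01 by simp
  have b1: "(\<lambda>x. h + (\<Sum>m\<in>N. G m x)) \<in> bcontfun"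
    by (intro plus_cont const_bcontfun bcontfun_sum Gb)
  have "L f \<le> L (\<lambda>x. (h + (\<Sum>m\<in>N. G m x)) + r x)"
    by (intro mono plus_cont b1 fb rb) (auto simp: r_def)
  also have "\<dots> = h + (\<Sum>m\<in>N. L (G m)) + L r"
    by (simp add: add b1 rb const_bcontfun bcontfun_sum Gb const sum)
  also have "\<dots> \<le> (\<Sum>m\<in>N. L (G m)) + e"
    using Lr by (simp add: h_def)
  finally have "ennreal (L f) \<le> ennreal ((\<Sum>m\<in>N. L (G m)) + e)"
    by (rule ennreal_leI)
  also have "\<dots> = (\<Sum>m\<in>N. ennreal (L (G m))) + ennreal e"
    using e subordinate_L(1)[OF Gs] by (simp add: sum_nonneg sum_ennreal)
  also have "\<dots> \<le> (\<Sum>m\<in>N. open_content (U m)) + ennreal e"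
    by (intro add_mono sum_mono open_content_upper Gs order_refl)
  also have "\<dots> \<le> (\<Sum>m. open_content (U m)) + ennreal e"
    by (intro add_mono sum_le_suminf finN) auto
  finally show "ennreal (L f) \<le> (\<Sum>m. open_content (U m)) + ennreal e" .
qed

text \<open>Each \<open>A n\<close> is enlarged to an open set at a cost of
  \<open>e / 2 ^ Suc n\<close>; these errors sum to \<open>e\<close>, and subadditivity on open sets
  applies.\<close>

lemma outer_content_countably_subadditive:
  "outer_content (\<Union>n::nat. A n) \<le> (\<Sum>n. outer_content (A n))"
proof (rule ennreal_le_epsilon)
  fix e :: real assume e: "0 < e"
  have "\<exists>U. open U \<and> A n \<subseteq> U \<and> open_content U \<le> outer_content (A n) + ennreal (e * (1 / 2) ^ Suc n)" for n
  proof -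
    have pos: "0 < e * (1 / 2) ^ Suc n" using e by simp
    obtain U where "open U" "A n \<subseteq> U" "open_content U \<le> outer_content (A n) + ennreal (e * (1 / 2) ^ Suc n)"
      by (rule outer_content_approx[OF pos])
    then show ?thesis by blast
  qed
  then obtain U where U: "\<And>n. open (U n)" "\<And>n. A n \<subseteq> U n"
    "\<And>n. open_content (U n) \<le> outer_content (A n) + ennreal (e * (1 / 2) ^ Suc n)"
    by metis
  have "outer_content (\<Union>n. A n) \<le> open_content (\<Union>n. U n)"
    unfolding outer_content_def using U(1,2) by (intro INF_lower) auto
  also have "\<dots> \<le> (\<Sum>n. open_content (U n))"
    by (rule open_content_countable_subadditive[OF U(1)])
  also have "\<dots> \<le> (\<Sum>n. outer_content (A n) + ennreal (e * (1 / 2) ^ Suc n))"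
    by (intro suminf_le U) auto
  also have "\<dots> = (\<Sum>n. outer_content (A n)) + ennreal e"
  proof -
    have "(\<lambda>n. e * (1 / 2) ^ Suc n) sums (e * 1)"
      by (intro sums_mult power_half_series)
    then have "(\<Sum>n. ennreal (e * (1 / 2) ^ Suc n)) = ennreal e"
      using e by (subst suminf_ennreal_eq) auto
    then show ?thesis by (subst suminf_add[symmetric]) auto
  qed
  finally show "outer_content (\<Union>n. A n) \<le> (\<Sum>n. outer_content (A n)) + ennreal e" .
qed

lemma outer_measure_space_outer_content: "outer_measure_space (Pow UNIV) outer_content"
  unfolding outer_measure_space_def
  using outer_content_countably_subadditive outer_content_mono outer_content_open[of "{}"]
  by (auto simp: positive_def increasing_def countably_subadditive_def open_content_empty)

section \<open>Caratheodory measurability of open sets\<close>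

text \<open>A nearly optimal \<open>f\<close> for \<open>V \<inter> U\<close> is small on
  \<open>W\<close>, an open set containing \<open>V - U\<close>. Adding a nearly optimal
  \<open>g\<close> for \<open>W\<close> gives a function bounded by \<open>1 + h\<close>, because
  \<open>f < h\<close> wherever \<open>g\<close> is nonzero. After division by \<open>1 + h\<close>
  it is subordinate to \<open>V\<close>.\<close>

lemma open_content_Int_Diff:
  assumes U: "open U" and V: "open V"
  shows "outer_content (V \<inter> U) + outer_content (V - U) \<le> open_content V"
proof (rule ennreal_le_epsilon)
  fix e :: real assume e: "0 < e"
  define h where "h = e / 3"
  have h: "0 < h" using e by (simp add: h_def)
  obtain f where f: "f \<in> subordinate (V \<inter> U)" "open_content (V \<inter> U) \<le> ennreal (L f + h)"
    using open_content_approx[OF h] by blast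
  have fb: "f \<in> bcontfun" and f01: "0 \<le> f x" "f x \<le> 1" and f0: "x \<notin> V \<inter> U \<Longrightarrow> f x = 0" for x
    using f(1) by (simp_all add: subordinate_def)
  define W where "W = V \<inter> {x. f x < h}"
  have W: "open W"
    unfolding W_def using V bcontfun_continuous[OF fb]
    by (intro open_Int open_Collect_less continuous_intros)
  have sub: "V - U \<subseteq> W" using f0 h by (auto simp: W_def)
  obtain g where g: "g \<in> subordinate W" "open_content W \<le> ennreal (L g + h)"
    using open_content_approx[OF h] by blast
  have gb: "g \<in> bcontfun" and g01: "0 \<le> g x" "g x \<le> 1" and g0: "x \<notin> W \<Longrightarrow> g x = 0" for x
    using g(1) by (simp_all add: subordinate_def)
  have le: "f x + g x \<le> 1 + h" for x
    using f01[of x] g01[of x] g0[of x] f0[of x] h by (cases "x \<in> W") (auto simp: W_def)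
  have s: "(\<lambda>x. (1 / (1 + h)) * (f x + g x)) \<in> subordinate V"
    unfolding subordinate_def
  proof (intro CollectI conjI allI impI)
    show "(\<lambda>x. (1 / (1 + h)) * (f x + g x)) \<in> bcontfun"
      by (intro bcontfun_scale plus_cont fb gb)
    show "0 \<le> (1 / (1 + h)) * (f x + g x)" "(1 / (1 + h)) * (f x + g x) \<le> 1" for x
      using h f01 g01 le[of x] by (auto simp: divide_le_eq)
    show "(1 / (1 + h)) * (f x + g x) = 0" if "x \<notin> V" for x
      using that f0[of x] g0[of x] by (simp add: W_def)
  qed
  have s1: "(1 / (1 + h)) * (L f + L g) \<le> 1"
    and s2: "ennreal ((1 / (1 + h)) * (L f + L g)) \<le> open_content V"
    using subordinate_L(2)[OF s] open_content_upper[OF s]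
    by (simp_all only: scale[OF plus_cont[OF fb gb]] add[OF fb gb])
  have Lf: "0 \<le> L f" "0 \<le> L g" using subordinate_L f g by blast+
  \<comment> \<open>Undoing the rescaling costs at most \<open>h\<close>, as \<open>L\<close> of the
    rescaled function is at most 1. The two near-optimality errors cost another
    \<open>2 * h\<close>, which explains \<open>h = e / 3\<close>.\<close>
  have "L f + L g = (1 + h) * ((1 / (1 + h)) * (L f + L g))"
    using h by simp
  also have "\<dots> = (1 / (1 + h)) * (L f + L g) + h * ((1 / (1 + h)) * (L f + L g))"
    by (simp only: distrib_right mult_1_left)
  also have "\<dots> \<le> (1 / (1 + h)) * (L f + L g) + h"
    using s1 h mult_left_mono[OF s1, of h] by simp
  finally have s3: "(L f + h) + (L g + h) \<le> (1 / (1 + h)) * (L f + L g) + e"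
    by (simp add: h_def)
  have "outer_content (V \<inter> U) + outer_content (V - U) \<le> open_content (V \<inter> U) + open_content W"
    using outer_content_mono[OF sub] U V W by (intro add_mono) (auto simp: outer_content_open open_Int)
  also have "\<dots> \<le> ennreal (L f + h) + ennreal (L g + h)"
    by (intro add_mono f g)
  also have "\<dots> = ennreal ((L f + h) + (L g + h))"
    using Lf h by (intro ennreal_plus[symmetric]) auto
  also have "\<dots> \<le> ennreal ((1 / (1 + h)) * (L f + L g) + e)"
    by (intro ennreal_leI s3)
  also have "\<dots> = ennreal ((1 / (1 + h)) * (L f + L g)) + ennreal e"
    using Lf h e by (intro ennreal_plus) auto
  also have "\<dots> \<le> open_content V + ennreal e"
    by (intro add_mono s2 order_refl)
  finally show "outer_content (V \<inter> U) + outer_content (V - U) \<le> open_content V + ennreal e" .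
qed

text \<open>Caratheodory's condition has to be tested on arbitrary \<open>A\<close>; passing to the
  infimum over open supersets reduces one inequality to open test sets. The other is
  subadditivity.\<close>

lemma open_in_lambda_system:
  assumes U: "open U"
  shows "U \<in> lambda_system UNIV (Pow UNIV) outer_content"
  unfolding lambda_system_def
proof (intro CollectI conjI ballI antisym)
  fix A :: "'a set"
  show "outer_content (U \<inter> A) + outer_content ((UNIV - U) \<inter> A) \<le> outer_content A"
    unfolding outer_content_def[of A]
  proof (rule INF_greatest)
    fix V assume "V \<in> {V. open V \<and> A \<subseteq> V}"
    then have V: "open V" "A \<subseteq> V" by auto
    have "outer_content (U \<inter> A) + outer_content ((UNIV - U) \<inter> A)
        \<le> outer_content (V \<inter> U) + outer_content (V - U)"
      using V(2) by (intro add_mono outer_content_mono) auto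
    also have "\<dots> \<le> open_content V"
      by (rule open_content_Int_Diff[OF U V(1)])
    finally show "outer_content (U \<inter> A) + outer_content ((UNIV - U) \<inter> A) \<le> open_content V" .
  qed
  interpret Pow: sigma_algebra UNIV "Pow (UNIV :: 'a set)"
    by (rule sigma_algebra_Pow)
  have "subadditive (Pow UNIV) outer_content"
    using outer_measure_space_outer_content unfolding outer_measure_space_def
    by (intro Pow.countably_subadditive_subadditive) auto
  then have "outer_content ((U \<inter> A) \<union> ((UNIV - U) \<inter> A))
      \<le> outer_content (U \<inter> A) + outer_content ((UNIV - U) \<inter> A)"
    by (rule subadditiveD) auto
  moreover have "(U \<inter> A) \<union> ((UNIV - U) \<inter> A) = A" by auto
  ultimately show "outer_content A \<le> outer_content (U \<inter> A) + outer_content ((UNIV - U) \<inter> A)"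
    by simp
qed simp

section \<open>The representing measure and its regularity\<close>

definition representing_measure :: "'a measure" where
  "representing_measure = measure_of UNIV (sets borel) outer_content"

text \<open>Caratheodory's theorem makes the outer measure countably additive on its measurable
  sets; these form a sigma-algebra containing the open sets, hence all Borel sets.\<close>

lemma measure_space_outer_content: "measure_space UNIV (sets borel) outer_content"
proof (rule measure_down)
  interpret Pow: sigma_algebra UNIV "Pow (UNIV :: 'a set)"
    by (rule sigma_algebra_Pow)
  show ms: "measure_space UNIV (lambda_system UNIV (Pow UNIV) outer_content) outer_content"
    by (rule Pow.caratheodory_lemma[OF outer_measure_space_outer_content])
  then interpret ls: sigma_algebra UNIV "lambda_system UNIV (Pow UNIV) outer_content"
    by (simp add: measure_space_def)
  show "sigma_algebra UNIV (sets (borel :: 'a measure))"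
    using sets.sigma_algebra_axioms[of "borel :: 'a measure"] by simp
  show "sets borel \<subseteq> lambda_system UNIV (Pow UNIV) outer_content"
  proof -
    have "sigma_sets UNIV {S. open S} \<subseteq> lambda_system UNIV (Pow UNIV) outer_content"
      by (rule ls.sigma_sets_subset) (auto intro: open_in_lambda_system simp del: Pow_UNIV)
    then show ?thesis by (simp add: borel_def)
  qed
qed

lemma sets_representing_measure [simp]: "sets representing_measure = sets borel"
  and space_representing_measure [simp]: "space representing_measure = UNIV"
  unfolding representing_measure_def
  using sets.sigma_sets_eq[of "borel :: 'a measure"] by (auto simp: sets_measure_of_conv space_measure_of_conv)

lemma emeasure_representing_measure:
  "A \<in> sets borel \<Longrightarrow> emeasure representing_measure A = outer_content A"
  using measure_space_outer_content unfolding representing_measure_def measure_space_def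
  by (intro emeasure_measure_of_sigma) auto

sublocale representing: prob_space representing_measure
  by (rule prob_spaceI) (simp add: emeasure_representing_measure outer_content_open open_content_UNIV)

lemma prob_representing_measure_UNIV [simp]: "measure representing_measure UNIV = 1"
  using representing.prob_space by simp

text \<open>Outer regularity is built into \<open>outer_content\<close>. Applied to the complement
  of \<open>B\<close> it gives a closed subset \<open>- V\<close> of \<open>B\<close>, and cutting
  with a compact \<open>K\<close> from tightness makes it compact. The lost mass lies in
  \<open>- K\<close> or in \<open>V - (- B)\<close>, each of measure at most
  \<open>h = e / 3\<close>.\<close>

lemma representing_measure_radon: "representing_measure \<in> radon_probs"
  unfolding radon_probs_def
proof (intro CollectI conjI ballI allI impI)
  fix B :: "'a set" and e :: real
  assume B: "B \<in> sets borel" and e: "0 < e"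
  define h where "h = e / 3"
  have h: "0 < h" using e by (simp add: h_def)
  obtain K where K: "compact K"
    "\<forall>f\<in>bcontfun. (\<forall>x. 0 \<le> f x \<and> f x \<le> 1) \<longrightarrow> (\<forall>x\<in>K. f x = 0) \<longrightarrow> L f \<le> h"
    using tight[OF h] by (elim exE conjE)
  have opK: "open (- K)" using K(1) by (simp add: compact_imp_closed open_Compl)
  have "open_content (- K) \<le> ennreal h"
    unfolding open_content_def using K(2) by (intro SUP_least ennreal_leI) (auto simp: subordinate_def)
  then have mK: "measure representing_measure (- K) \<le> h"
    using opK h unfolding measure_def
    by (simp add: emeasure_representing_measure outer_content_open enn2real_leI)
  obtain V where V: "open V" "- B \<subseteq> V" "open_content V \<le> outer_content (- B) + ennreal h"
    by (rule outer_content_approx[OF h])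
  have "ennreal (measure representing_measure V) \<le> ennreal (measure representing_measure (- B) + h)"
    using V B h
    by (simp add: representing.emeasure_eq_measure[symmetric] emeasure_representing_measure outer_content_open)
  then have mV: "measure representing_measure V \<le> measure representing_measure (- B) + h"
    using h by (subst (asm) ennreal_le_iff) (auto intro: add_nonneg_nonneg)
  have cV: "closed (- V)" using V(1) by (rule closed_Compl)
  have "measure representing_measure (B - (K \<inter> - V))
      \<le> measure representing_measure (- K \<union> (V - (- B)))"
    using B V opK by (intro representing.finite_measure_mono) auto
  also have "\<dots> \<le> measure representing_measure (- K) + measure representing_measure (V - (- B))"
    using B V opK by (intro measure_subadditive) auto
  also have "measure representing_measure (V - (- B))
      = measure representing_measure V - measure representing_measure (- B)"
    using B V by (intro representing.finite_measure_Diff) auto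
  finally have "measure representing_measure (B - (K \<inter> - V)) < e"
    using mK mV h by (simp add: h_def)
  moreover have "compact (K \<inter> - V)" "K \<inter> - V \<subseteq> B"
    using K(1) cV V(2) by (auto intro: compact_Int_closed)
  ultimately show "\<exists>K. compact K \<and> K \<subseteq> B \<and> measure representing_measure (B - K) < e"
    by blast
qed (auto intro: representing.prob_space_axioms)

section \<open>Integration against the representing measure\<close>

text \<open>The function is cut into \<open>n\<close> horizontal slices. Slice \<open>k\<close> is
  subordinate to the level set \<open>E k\<close>, so \<open>L\<close> of it is at most the measure
  of \<open>E k\<close>; and the sum of the indicators of the \<open>E k\<close> exceeds
  \<open>n * f\<close> by at most 1, so the total error is \<open>1 / n\<close>.\<close>

lemma le_integral_representing_measure:
  assumes fb: "f \<in> bcontfun" and f01: "\<And>x. 0 \<le> f x" "\<And>x. f x \<le> 1"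
  shows "L f \<le> (\<integral>x. f x \<partial>representing_measure)"
proof (rule field_le_epsilon)
  fix e :: real assume "0 < e"
  obtain n :: nat where n: "0 < n" "inverse (real n) < e"
    using ex_inverse_of_nat_less[OF \<open>0 < e\<close>] by blast
  let ?M = representing_measure
  \<comment> \<open>The part of \<open>f\<close> between the heights \<open>k / n\<close> and
    \<open>(k + 1) / n\<close>, stretched to the unit interval.\<close>
  define c where "c k x = real n * (min (f x) (real (Suc k) / n) - min (f x) (real k / n))" for k x
  define E where "E k = {x. real k / n < f x}" for k
  have E: "open (E k)" for k
    unfolding E_def using bcontfun_continuous[OF fb] by (intro open_Collect_less continuous_intros)
  have c: "c k \<in> subordinate (E k)" for k
    unfolding subordinate_def
  proof (intro CollectI conjI allI impI)
    have "continuous_on UNIV (c k)"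
      unfolding c_def by (intro continuous_intros bcontfun_continuous fb)
    moreover show "0 \<le> c k x" for x
      unfolding c_def using n by (intro mult_nonneg_nonneg) (auto simp: min_def divide_right_mono field_simps)
    moreover show "c k x \<le> 1" for x
      unfolding c_def using n by (auto simp: min_def field_simps)
    ultimately show "c k \<in> bcontfun" by (rule bcontfunI_real)
    show "c k x = 0" if "x \<notin> E k" for x
    proof -
      have "f x \<le> real k / n" using that by (simp add: E_def)
      moreover have "real k / n \<le> real (Suc k) / n" by (simp add: divide_right_mono)
      ultimately show ?thesis unfolding c_def by simp
    qed
  qed
  have cb: "c k \<in> bcontfun" for k using c[of k] by (simp add: subordinate_def)
  have fc: "f = (\<lambda>x. (1 / n) * (\<Sum>k<n. c k x))"
  proof
    fix x
    \<comment> \<open>The slices telescope; the top term is \<open>f x\<close> because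
      \<open>f x \<le> 1\<close>, the bottom term is 0 because \<open>0 \<le> f x\<close>.\<close>
    have "(\<Sum>k<n. c k x) = real n * (min (f x) (real n / n) - min (f x) (real 0 / n))"
      unfolding c_def sum_distrib_left[symmetric] sum_lessThan_telescope[of "\<lambda>k. min (f x) (real k / n)"] ..
    then show "f x = (1 / n) * (\<Sum>k<n. c k x)"
      using n f01[of x] by simp
  qed
  have Lc: "L (c k) \<le> measure ?M (E k)" for k
  proof -
    have "ennreal (L (c k)) \<le> emeasure ?M (E k)"
      using open_content_upper[OF c] E by (simp add: emeasure_representing_measure outer_content_open)
    then show ?thesis
      by (simp add: representing.emeasure_eq_measure)
  qed
  have [simp]: "integrable ?M (indicator (E k) :: _ \<Rightarrow> real)" for k
    using E by (intro integrable_real_indicator) (auto simp: less_top[symmetric])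
  have count: "(\<Sum>k<N. indicator (E k) x) \<le> n * f x + 1" for N :: nat and x
    unfolding E_def using count_nat_less_le[of "n * f x" N] n f01(1)[of x]
    by (simp add: indicator_def of_bool_def field_simps)
  have "L f = (1 / n) * (\<Sum>k<n. L (c k))"
    by (subst fc) (simp only: scale bcontfun_sum cb sum)
  also have "\<dots> \<le> (1 / n) * (\<Sum>k<n. measure ?M (E k))"
    by (intro mult_left_mono sum_mono Lc) auto
  also have "\<dots> = (\<integral>x. (1 / n) * (\<Sum>k<n. indicator (E k) x) \<partial>?M)"
    using E by (simp add: Bochner_Integration.integral_sum)
  also have "\<dots> \<le> (\<integral>x. f x + inverse n \<partial>?M)"
  proof (rule integral_mono)
    show "integrable ?M (\<lambda>x. f x + inverse n)"
      by (intro Bochner_Integration.integrable_add integrable_bcontfun fb)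
         (auto simp: representing.finite_measure_axioms const_bcontfun)
    show "(1 / n) * (\<Sum>k<n. indicator (E k) x) \<le> f x + inverse n" for x
      using count[of x n] n by (simp add: field_simps)
  qed simp
  also have "\<dots> = (\<integral>x. f x \<partial>?M) + inverse n"
    using integrable_bcontfun[OF representing.finite_measure_axioms sets_representing_measure fb]
    by (subst Bochner_Integration.integral_add) auto
  finally show "L f \<le> (\<integral>x. f x \<partial>?M) + e"
    using n by simp
qed

text \<open>The one-sided bound extends from values in the unit interval to
  \<open>\<bar>g x\<bar> \<le> b\<close> by the affine map sending \<open>g\<close> to
  \<open>(g + b) / (2 * b)\<close>. Applying it to both \<open>f\<close> and \<open>- f\<close>
  gives equality.\<close>

theorem integral_representing_measure:
  assumes fb: "f \<in> bcontfun"
  shows "(\<integral>x. f x \<partial>representing_measure) = L f"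
proof -
  let ?M = representing_measure
  note int = integrable_bcontfun[OF representing.finite_measure_axioms sets_representing_measure]
  obtain b where b: "\<And>x. \<bar>f x\<bar> \<le> b" "0 < b"
    using fb unfolding bcontfun_def bounded_pos by auto
  have le: "L g \<le> (\<integral>x. g x \<partial>?M)" if g: "g \<in> bcontfun" "\<And>x. \<bar>g x\<bar> \<le> b" for g
  proof -
    have g01: "0 \<le> (1 / (2 * b)) * (g x + b)" "(1 / (2 * b)) * (g x + b) \<le> 1" for x
      using g(2)[of x] b(2) by (auto simp: field_simps abs_le_iff)
    have gb: "(\<lambda>x. g x + b) \<in> bcontfun" by (intro plus_cont g const_bcontfun)
    have "L (\<lambda>x. (1 / (2 * b)) * (g x + b)) \<le> (\<integral>x. (1 / (2 * b)) * (g x + b) \<partial>?M)"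
      by (rule le_integral_representing_measure[OF bcontfun_scale[OF gb] g01])
    also have "L (\<lambda>x. (1 / (2 * b)) * (g x + b)) = (1 / (2 * b)) * (L g + b)"
      by (simp only: scale[OF gb] add[OF g(1) const_bcontfun] const)
    also have "(\<integral>x. (1 / (2 * b)) * (g x + b) \<partial>?M) = (1 / (2 * b)) * ((\<integral>x. g x \<partial>?M) + b)"
      using int[OF g(1)] by simp
    finally show ?thesis using b(2) by (simp add: divide_le_cancel)
  qed
  have "L (\<lambda>x. - 1 * f x) \<le> (\<integral>x. - 1 * f x \<partial>?M)"
    using b by (intro le bcontfun_scale fb) auto
  then have "- L f \<le> - (\<integral>x. f x \<partial>?M)"
    by (simp only: scale[OF fb]) simp
  with le[OF fb b(1)] show ?thesis by simp
qed

end

section \<open>Radon probability measures and couplings\<close>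

lemma radon_probsD:
  assumes "M \<in> radon_probs"
  shows "prob_space M" "finite_measure M" "sets M = sets borel" "space M = UNIV"
  using assms sets_eq_imp_space_eq[of M borel]
  by (auto simp: radon_probs_def prob_space.finite_measure)

lemma radon_probs_inner_regular:
  assumes M: "M \<in> radon_probs" and B: "B \<in> sets borel" and e: "0 < e"
  obtains K where "compact K" "K \<subseteq> B" "measure M B \<le> measure M K + e"
proof -
  interpret prob_space M using radon_probsD[OF M] by simp
  obtain K where K: "compact K" "K \<subseteq> B" "measure M (B - K) < e"
    using M B e unfolding radon_probs_def by blast
  have "K \<in> sets borel" using K(1) by (simp add: borel_compact)
  then have "measure M (B - K) = measure M B - measure M K"
    using K B radon_probsD(3)[OF M] by (intro finite_measure_Diff) auto
  with K that show thesis by force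
qed

lemma integral_bcontfun_bounds:
  fixes f :: "'a::t2_space \<Rightarrow> real"
  assumes M: "prob_space M" "sets M = sets borel" and f: "f \<in> bcontfun"
    and K: "compact K" "\<And>x. x \<in> K \<Longrightarrow> f x = 1"
    and U: "open U" "\<And>x. x \<notin> U \<Longrightarrow> f x = 0"
    and f01: "\<And>x. 0 \<le> f x" "\<And>x. f x \<le> 1"
  shows "measure M K \<le> (\<integral>x. f x \<partial>M)" "(\<integral>x. f x \<partial>M) \<le> measure M U"
proof -
  interpret prob_space M by fact
  have sp: "space M = UNIV" using sets_eq_imp_space_eq[OF M(2)] by simp
  have Ks: "K \<in> sets M" and Us: "U \<in> sets M"
    using K(1) U(1) M(2) by (auto simp: borel_compact)
  have int: "integrable M f"
    by (intro integrable_bcontfun f M finite_measure_axioms)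
  have "measure M K = (\<integral>x. indicator K x \<partial>M)" using Ks by simp
  also have "\<dots> \<le> (\<integral>x. f x \<partial>M)"
    using Ks K(2) f01 by (intro integral_mono int integrable_real_indicator) (auto simp: indicator_def less_top[symmetric])
  finally show "measure M K \<le> (\<integral>x. f x \<partial>M)" .
  have "(\<integral>x. f x \<partial>M) \<le> (\<integral>x. indicator U x \<partial>M)"
    using Us U(2) f01 by (intro integral_mono int integrable_real_indicator) (auto simp: indicator_def less_top[symmetric])
  then show "(\<integral>x. f x \<partial>M) \<le> measure M U" using Us by simp
qed

section \<open>Radon measures are determined by bounded continuous functions\<close>

text \<open>Inner regularity of \<open>M\<close> replaces \<open>U\<close> by a compact
  \<open>K\<close>. A cutoff between the indicators of \<open>K\<close> and \<open>U\<close> has the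
  same integral for both measures, so the mass of \<open>K\<close> under \<open>M\<close> is at most
  that of \<open>U\<close> under \<open>N\<close>.\<close>

lemma radon_probs_open_le:
  fixes M N :: "'a::t2_space measure"
  assumes cr: "completely_regular_space (euclidean :: 'a topology)"
    and M: "M \<in> radon_probs" and N: "N \<in> radon_probs"
    and eq: "\<And>f :: 'a \<Rightarrow> real. f \<in> bcontfun \<Longrightarrow> (\<integral>x. f x \<partial>M) = (\<integral>x. f x \<partial>N)"
    and U: "open U"
  shows "measure M U \<le> measure N U"
proof (rule field_le_epsilon)
  fix e :: real assume e: "0 < e"
  have "U \<in> sets borel" using U by simp
  then obtain K where K: "compact K" "K \<subseteq> U" "measure M U \<le> measure M K + e"
    using radon_probs_inner_regular[OF M _ e] by blast
  obtain f :: "'a \<Rightarrow> real" where f: "f \<in> bcontfun" "\<And>x. 0 \<le> f x" "\<And>x. f x \<le> 1"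
    "\<And>x. x \<in> K \<Longrightarrow> f x = 1" "\<And>x. x \<notin> U \<Longrightarrow> f x = 0"
    by (rule Urysohn_bcontfun[OF cr K(1) U K(2)], rule that)
  have "measure M K \<le> (\<integral>x. f x \<partial>M)"
    using integral_bcontfun_bounds(1)[OF radon_probsD(1,3)[OF M] f(1) K(1) f(4) U f(5) f(2,3)] by simp
  also have "\<dots> \<le> measure N U"
    unfolding eq[OF f(1)]
    using integral_bcontfun_bounds(2)[OF radon_probsD(1,3)[OF N] f(1) K(1) f(4) U f(5) f(2,3)] by simp
  finally show "measure M U \<le> measure N U + e" using K(3) by simp
qed

text \<open>Equality on open sets suffices, as they are closed under intersection and generate the
  Borel sets. This identifies the marginals of limit points.\<close>

lemma radon_probs_eqI:
  fixes M N :: "'a::t2_space measure"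
  assumes cr: "completely_regular_space (euclidean :: 'a topology)"
    and M: "M \<in> radon_probs" and N: "N \<in> radon_probs"
    and eq: "\<And>f :: 'a \<Rightarrow> real. f \<in> bcontfun \<Longrightarrow> (\<integral>x. f x \<partial>M) = (\<integral>x. f x \<partial>N)"
  shows "M = N"
proof (rule measure_eqI_generator_eq[where E = "{S. open S}" and \<Omega> = UNIV and A = "\<lambda>_. UNIV"])
  interpret M: prob_space M using radon_probsD[OF M] by simp
  interpret N: prob_space N using radon_probsD[OF N] by simp
  show "Int_stable {S :: 'a set. open S}" by (auto simp: Int_stable_def)
  show "emeasure M X = emeasure N X" if "X \<in> {S. open S}" for X
    using radon_probs_open_le[OF cr M N eq] radon_probs_open_le[OF cr N M eq[symmetric]] that
    by (simp add: M.emeasure_eq_measure N.emeasure_eq_measure antisym)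
  show "sets M = sigma_sets UNIV {S. open S}" "sets N = sigma_sets UNIV {S. open S}"
    using radon_probsD(3)[OF M] radon_probsD(3)[OF N] by (simp_all add: borel_def)
qed (auto simp: finite_measure.emeasure_finite[OF radon_probsD(2)[OF M]])

text \<open>A compact set filling most of the preimage of \<open>B\<close> has a compact image
  filling most of \<open>B\<close>. Applied to the projections, it shows that marginals of Radon
  measures are Radon.\<close>

lemma radon_probs_distr:
  fixes g :: "'a::t2_space \<Rightarrow> 'b::t2_space"
  assumes M: "M \<in> radon_probs" and g: "continuous_on UNIV g"
  shows "distr M borel g \<in> radon_probs"
  unfolding radon_probs_def
proof (intro CollectI conjI ballI allI impI)
  have meas: "g \<in> measurable M borel"
    using borel_measurable_continuous_onI[OF g] radon_probsD(3)[OF M] by (simp cong: measurable_cong_sets)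
  then show "prob_space (distr M borel g)"
    using radon_probsD(1)[OF M] by (simp add: prob_space.prob_space_distr)
  fix B :: "'b set" and e :: real
  assume B: "B \<in> sets borel" and e: "0 < e"
  have pre: "g -` B \<in> sets borel"
    using measurable_sets[OF meas B] radon_probsD(3,4)[OF M] by simp
  then obtain K where K: "compact K" "K \<subseteq> g -` B" "measure M (g -` B - K) < e"
    using M e unfolding radon_probs_def by blast
  have cK: "compact (g ` K)"
    using K(1) g by (intro compact_continuous_image continuous_on_subset[OF g]) auto
  then have gK: "g ` K \<in> sets borel" by (simp add: borel_compact)
  have "measure (distr M borel g) (B - g ` K) = measure M (g -` (B - g ` K))"
    using B gK radon_probsD(4)[OF M] by (subst measure_distr[OF meas]) auto
  also have "\<dots> \<le> measure M (g -` B - K)"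
    using pre borel_compact[OF K(1)] radon_probsD(3)[OF M]
    by (intro finite_measure.finite_measure_mono[OF radon_probsD(2)[OF M]]) auto
  finally have "measure (distr M borel g) (B - g ` K) < e" using K(3) by simp
  then show "\<exists>K. compact K \<and> K \<subseteq> B \<and> measure (distr M borel g) (B - K) < e"
    using cK K(2) by (intro exI[of _ "g ` K"]) auto
qed simp

lemma bcontfun_compose:
  fixes f :: "'b::topological_space \<Rightarrow> real" and g :: "'a::topological_space \<Rightarrow> 'b"
  assumes "f \<in> bcontfun" "continuous_on UNIV g"
  shows "(\<lambda>x. f (g x)) \<in> bcontfun"
proof -
  obtain b where "\<And>x. norm (f x) \<le> b"
    using assms(1) unfolding bcontfun_def bounded_iff by auto
  then show ?thesis
    using continuous_on_compose2[OF bcontfun_continuous[OF assms(1)] assms(2)]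
    by (intro bcontfun_normI) auto
qed

section \<open>Marginals of limit points\<close>

lemma couplings_integral:
  fixes f :: "'a::t2_space \<Rightarrow> real"
  assumes \<pi>: "\<pi> \<in> couplings \<mu> \<nu>" and f: "f \<in> bcontfun"
  shows "(\<integral>p. f (fst p) \<partial>\<pi>) = (\<integral>x. f x \<partial>\<mu>)" "(\<integral>p. f (snd p) \<partial>\<pi>) = (\<integral>x. f x \<partial>\<nu>)"
proof -
  have rd: "\<pi> \<in> radon_probs" and \<mu>: "\<mu> = distr \<pi> borel fst" and \<nu>: "\<nu> = distr \<pi> borel snd"
    using \<pi> by (auto simp: couplings_def)
  have "fst \<in> measurable \<pi> (borel :: 'a measure)" "snd \<in> measurable \<pi> (borel :: 'a measure)"
    using borel_measurable_continuous_onI[of "fst :: 'a \<times> 'a \<Rightarrow> 'a"]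
      borel_measurable_continuous_onI[of "snd :: 'a \<times> 'a \<Rightarrow> 'a"] radon_probsD(3)[OF rd]
    by (auto simp: continuous_on_fst continuous_on_snd continuous_on_id cong: measurable_cong_sets)
  moreover have "f \<in> borel_measurable borel"
    by (rule borel_measurable_continuous_onI[OF bcontfun_continuous[OF f]])
  ultimately show "(\<integral>p. f (fst p) \<partial>\<pi>) = (\<integral>x. f x \<partial>\<mu>)" "(\<integral>p. f (snd p) \<partial>\<pi>) = (\<integral>x. f x \<partial>\<nu>)"
    unfolding \<mu> \<nu> by (simp_all add: integral_distr)
qed

text \<open>Otherwise disjoint neighbourhoods of the two reals would contain the integrals, one of
  them frequently and the other eventually.\<close>

lemma net_limit_point_integral_eq:
  fixes f :: "'b::t2_space \<Rightarrow> real"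
  assumes "net_limit_point weak_topology \<pi>s F \<pi>" and f: "f \<in> bcontfun"
    and lim: "((\<lambda>i. \<integral>x. f x \<partial>\<pi>s i) \<longlongrightarrow> l) F"
  shows "(\<integral>x. f x \<partial>\<pi>) = l"
proof (rule ccontr)
  have \<pi>: "\<pi> \<in> radon_probs" and
    freq: "\<forall>U. openin weak_topology U \<and> \<pi> \<in> U \<longrightarrow> (\<exists>\<^sub>F i in F. \<pi>s i \<in> U)"
    using assms(1) by (simp_all add: net_limit_point_def topspace_weak_topology)
  assume "(\<integral>x. f x \<partial>\<pi>) \<noteq> l"
  then obtain V W where VW: "open V" "open W" "(\<integral>x. f x \<partial>\<pi>) \<in> V" "l \<in> W" "V \<inter> W = {}"
    by (metis hausdorff)
  have "openin weak_topology {M \<in> radon_probs. (\<integral>x. f x \<partial>M) \<in> V}"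
    unfolding weak_topology_def using f VW by (intro topology_generated_by_Basis) auto
  then have "\<exists>\<^sub>F i in F. \<pi>s i \<in> {M \<in> radon_probs. (\<integral>x. f x \<partial>M) \<in> V}"
    using \<pi> VW(3) by (intro freq[rule_format]) simp
  moreover have "\<forall>\<^sub>F i in F. (\<integral>x. f x \<partial>\<pi>s i) \<in> W"
    using lim VW(2,4) by (rule topological_tendstoD)
  ultimately have "\<exists>\<^sub>F i in F. \<pi>s i \<in> {M \<in> radon_probs. (\<integral>x. f x \<partial>M) \<in> V} \<and> (\<integral>x. f x \<partial>\<pi>s i) \<in> W"
    by (rule frequently_eventually_frequently)
  then show False using VW(5) by (auto dest!: frequently_ex)
qed

text \<open>Integrals of functions of one coordinate depend only on a marginal, so they converge
  along the whole net. The limit point must reproduce these limits, and bounded continuous functions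
  determine its Radon marginals.\<close>

lemma net_limit_point_couplings:
  fixes \<mu> \<nu> :: "'a::t2_space measure"
  assumes cr: "completely_regular_space (euclidean :: 'a topology)"
    and cp: "\<forall>\<^sub>F i in F. \<pi>s i \<in> couplings (\<mu>s i) (\<nu>s i)"
    and \<mu>: "\<mu> \<in> radon_probs" "weakly_converges \<mu>s \<mu> F"
    and \<nu>: "\<nu> \<in> radon_probs" "weakly_converges \<nu>s \<nu> F"
    and lp: "net_limit_point weak_topology \<pi>s F \<pi>"
  shows "\<pi> \<in> couplings \<mu> \<nu>"
proof -
  have \<pi>: "\<pi> \<in> radon_probs"
    using lp by (simp add: net_limit_point_def topspace_weak_topology)
  have c: "continuous_on UNIV (fst :: 'a \<times> 'a \<Rightarrow> 'a)" "continuous_on UNIV (snd :: 'a \<times> 'a \<Rightarrow> 'a)"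
    by (intro continuous_intros)+
  \<comment> \<open>Any Radon measure couples its own marginals, so
    \<open>couplings_integral\<close> also applies to \<open>\<pi>\<close> before its marginals are
    identified.\<close>
  have \<pi>c: "\<pi> \<in> couplings (distr \<pi> borel fst) (distr \<pi> borel snd)"
    using \<pi> by (simp add: couplings_def)
  have "distr \<pi> borel fst = \<mu>"
  proof (rule radon_probs_eqI[OF cr radon_probs_distr[OF \<pi> c(1)] \<mu>(1)])
    fix f :: "'a \<Rightarrow> real" assume f: "f \<in> bcontfun"
    have "\<forall>\<^sub>F i in F. (\<integral>x. f x \<partial>\<mu>s i) = (\<integral>p. f (fst p) \<partial>\<pi>s i)"
      using cp by eventually_elim (simp add: couplings_integral(1)[OF _ f])
    then have "((\<lambda>i. \<integral>p. f (fst p) \<partial>\<pi>s i) \<longlongrightarrow> (\<integral>x. f x \<partial>\<mu>)) F"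
      using \<mu>(2) f unfolding weakly_converges_def by (auto intro: Lim_transform_eventually)
    from net_limit_point_integral_eq[OF lp bcontfun_compose[OF f c(1)] this]
    show "(\<integral>x. f x \<partial>distr \<pi> borel fst) = (\<integral>x. f x \<partial>\<mu>)"
      using couplings_integral(1)[OF \<pi>c f] by simp
  qed
  moreover have "distr \<pi> borel snd = \<nu>"
  proof (rule radon_probs_eqI[OF cr radon_probs_distr[OF \<pi> c(2)] \<nu>(1)])
    fix f :: "'a \<Rightarrow> real" assume f: "f \<in> bcontfun"
    have "\<forall>\<^sub>F i in F. (\<integral>x. f x \<partial>\<nu>s i) = (\<integral>p. f (snd p) \<partial>\<pi>s i)"
      using cp by eventually_elim (simp add: couplings_integral(2)[OF _ f])
    then have "((\<lambda>i. \<integral>p. f (snd p) \<partial>\<pi>s i) \<longlongrightarrow> (\<integral>x. f x \<partial>\<nu>)) F"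
      using \<nu>(2) f unfolding weakly_converges_def by (auto intro: Lim_transform_eventually)
    from net_limit_point_integral_eq[OF lp bcontfun_compose[OF f c(2)] this]
    show "(\<integral>x. f x \<partial>distr \<pi> borel snd) = (\<integral>x. f x \<partial>\<nu>)"
      using couplings_integral(2)[OF \<pi>c f] by simp
  qed
  ultimately show ?thesis using \<pi> by (simp add: couplings_def)
qed

section \<open>Existence of limit points\<close>

text \<open>Each functional is a point of a product of compact intervals, so Tychonoff's theorem
  provides a cluster point. A finer proper filter \<open>G\<close> takes the place of a
  subnet.\<close>

lemma cluster_functional:
  fixes M :: "'i \<Rightarrow> 'b::t2_space measure"
  assumes F: "F \<noteq> bot" and M: "\<forall>\<^sub>F i in F. M i \<in> radon_probs"
  obtains G L where "G \<le> F" "G \<noteq> bot"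
    "\<And>f :: 'b \<Rightarrow> real. f \<in> bcontfun \<Longrightarrow> ((\<lambda>i. \<integral>x. f x \<partial>M i) \<longlongrightarrow> L f) G"
proof -
  have "\<exists>b. f \<in> bcontfun \<longrightarrow> (\<forall>x. \<bar>f x\<bar> \<le> b)" for f :: "'b \<Rightarrow> real"
    unfolding bcontfun_def bounded_iff real_norm_def by blast
  then obtain b where b: "\<And>(f :: 'b \<Rightarrow> real) x. f \<in> bcontfun \<Longrightarrow> \<bar>f x\<bar> \<le> b f"
    by metis
  \<comment> \<open>The product runs over all functions; the default value 0 confines the
    coordinates outside \<open>bcontfun\<close> to a compact set.\<close>
  define \<Phi> where "\<Phi> i f = (if f \<in> bcontfun then \<integral>x. f x \<partial>M i else 0)" for i and f :: "'b \<Rightarrow> real"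
  define S where "S f = (if f \<in> bcontfun then {- b f..b f} else {0})" for f
  have "compactin (product_topology (\<lambda>_. euclidean) UNIV) (PiE UNIV S)"
    by (auto simp: compactin_PiE S_def)
  then have comp: "compact (PiE UNIV S)"
    by (simp add: euclidean_product_topology)
  have "\<forall>\<^sub>F i in F. \<Phi> i \<in> PiE UNIV S"
    using M
  proof eventually_elim
    case (elim i)
    interpret prob_space "M i" using radon_probsD[OF elim] by simp
    have "\<bar>\<integral>x. f x \<partial>M i\<bar> \<le> b f" if f: "f \<in> bcontfun" for f
    proof -
      have int: "integrable (M i) f"
        by (intro integrable_bcontfun f radon_probsD(2,3)[OF elim])
      have "\<bar>\<integral>x. f x \<partial>M i\<bar> \<le> (\<integral>x. \<bar>f x\<bar> \<partial>M i)" by (rule integral_abs_bound)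
      also have "\<dots> \<le> (\<integral>x. b f \<partial>M i)"
        using int b[OF f] by (intro integral_mono) auto
      finally show ?thesis by (simp add: prob_space)
    qed
    then show ?case by (auto simp: \<Phi>_def S_def abs_le_iff) (meson minus_le_iff)
  qed
  then obtain L where L: "inf (nhds L) (filtermap \<Phi> F) \<noteq> bot"
    using compact_filter[THEN iffD1, OF comp, rule_format, of "filtermap \<Phi> F"] F
    by (auto simp: eventually_filtermap filtermap_bot_iff)
  \<comment> \<open>The coarsest filter below \<open>F\<close> along which \<open>\<Phi>\<close>
    tends to \<open>L\<close>. It is proper precisely because \<open>L\<close> is a cluster
    point.\<close>
  define G where "G = inf F (filtercomap \<Phi> (nhds L))"
  have "G \<noteq> bot"
  proof
    assume "G = bot"
    then have "eventually (\<lambda>_. False) G" by simp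
    then obtain Q R where QR: "eventually Q F" "eventually R (filtercomap \<Phi> (nhds L))"
      "\<And>x. Q x \<Longrightarrow> R x \<Longrightarrow> False"
      unfolding G_def eventually_inf by auto
    then obtain R' where R': "eventually R' (nhds L)" "\<And>x. R' (\<Phi> x) \<Longrightarrow> R x"
      by (auto simp: eventually_filtercomap)
    have "eventually (\<lambda>y. \<not> R' y) (filtermap \<Phi> F)"
      unfolding eventually_filtermap using QR(1) by (rule eventually_mono) (use QR R' in blast)
    with R'(1) have "eventually (\<lambda>_. False) (inf (nhds L) (filtermap \<Phi> F))"
      unfolding eventually_inf by blast
    with L show False by (simp add: trivial_limit_def)
  qed
  moreover have "G \<le> F" by (simp add: G_def)
  moreover have "((\<lambda>i. \<integral>x. f x \<partial>M i) \<longlongrightarrow> L f) G" if f: "f \<in> bcontfun" for f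
  proof -
    have "filterlim \<Phi> (nhds L) G"
      unfolding G_def filterlim_iff_le_filtercomap by simp
    moreover have "continuous_on UNIV (\<lambda>L :: ('b \<Rightarrow> real) \<Rightarrow> real. L f)"
      by (rule continuous_on_product_coordinates)
    ultimately have "((\<lambda>i. \<Phi> i f) \<longlongrightarrow> L f) G"
      by (intro continuous_on_tendsto_compose[where f = "\<lambda>L. L f" and g = \<Phi> and s = UNIV]) auto
    then show ?thesis using f by (simp add: \<Phi>_def)
  qed
  ultimately show thesis using that by blast
qed

text \<open>Linearity, positivity and normalisation pass to the cluster functional directly.
  Tightness is extracted from the limits \<open>\<mu>\<close> and \<open>\<nu>\<close>; the limit is
  then the representing measure.\<close>

lemma couplings_cluster:
  fixes \<mu> \<nu> :: "'a::t2_space measure"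
  assumes cr: "completely_regular_space (euclidean :: 'a topology)"
    and F: "F \<noteq> bot"
    and cp: "\<forall>\<^sub>F i in F. \<pi>s i \<in> couplings (\<mu>s i) (\<nu>s i)"
    and \<mu>: "\<mu> \<in> radon_probs" "weakly_converges \<mu>s \<mu> F"
    and \<nu>: "\<nu> \<in> radon_probs" "weakly_converges \<nu>s \<nu> F"
  obtains G \<pi> where "G \<le> F" "G \<noteq> bot" "\<pi> \<in> radon_probs" "weakly_converges \<pi>s \<pi> G"
proof -
  have rdF: "\<forall>\<^sub>F i in F. \<pi>s i \<in> radon_probs"
    using cp by eventually_elim (simp add: couplings_def)
  obtain G L where G: "G \<le> F" "G \<noteq> bot"
    and L: "\<And>f :: 'a \<times> 'a \<Rightarrow> real. f \<in> bcontfun \<Longrightarrow> ((\<lambda>i. \<integral>x. f x \<partial>\<pi>s i) \<longlongrightarrow> L f) G"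
    by (rule cluster_functional[OF F rdF], rule that)
  have rd: "\<forall>\<^sub>F i in G. \<pi>s i \<in> radon_probs" and cpG: "\<forall>\<^sub>F i in G. \<pi>s i \<in> couplings (\<mu>s i) (\<nu>s i)"
    using rdF cp G(1) by (auto intro: filter_leD)
  have int: "integrable M f" if "M \<in> radon_probs" "f \<in> bcontfun" for M and f :: "'a \<times> 'a \<Rightarrow> real"
    using integrable_bcontfun[OF radon_probsD(2,3)[OF that(1)] that(2)] .
  have LI: "L f = l" if "f \<in> bcontfun" "((\<lambda>i. \<integral>x. f x \<partial>\<pi>s i) \<longlongrightarrow> l) G" for f l
    using tendsto_unique[OF G(2) L[OF that(1)] that(2)] .
  interpret tight_functional L
  proof
    show "completely_regular_space (euclidean :: ('a \<times> 'a) topology)"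
      by (intro completely_regular_space_euclidean_prod cr)
    show "L (\<lambda>x. f x + g x) = L f + L g" if f: "f \<in> bcontfun" and g: "g \<in> bcontfun" for f g
    proof (rule LI)
      have "\<forall>\<^sub>F i in G. (\<integral>x. f x \<partial>\<pi>s i) + (\<integral>x. g x \<partial>\<pi>s i) = (\<integral>x. f x + g x \<partial>\<pi>s i)"
        using rd by eventually_elim (simp add: int f g)
      then show "((\<lambda>i. \<integral>x. f x + g x \<partial>\<pi>s i) \<longlongrightarrow> L f + L g) G"
        by (rule Lim_transform_eventually[OF tendsto_add[OF L[OF f] L[OF g]]])
    qed (intro plus_cont f g)
    show "L (\<lambda>x. r * f x) = r * L f" if f: "f \<in> bcontfun" for f r
      using tendsto_mult_left[OF L[OF f], of r] by (intro LI bcontfun_scale f) simp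
    show "0 \<le> L f" if f: "f \<in> bcontfun" and "\<And>x. 0 \<le> f x" for f
      using L[OF f] by (rule tendsto_lowerbound[OF _ _ G(2)]) (simp add: that)
    show "L (\<lambda>_. 1) = 1"
    proof (rule LI[OF const_bcontfun])
      have "\<forall>\<^sub>F i in G. (1 :: real) = (\<integral>x. 1 \<partial>\<pi>s i)"
        using rd
      proof eventually_elim
        case (elim i)
        interpret P: prob_space "\<pi>s i" using radon_probsD(1)[OF elim] .
        show ?case by (simp add: P.prob_space)
      qed
      then show "((\<lambda>i. \<integral>x. 1 \<partial>\<pi>s i) \<longlongrightarrow> (1 :: real)) G"
        by (rule Lim_transform_eventually[OF tendsto_const])
    qed
    \<comment> \<open>Error budget: \<open>e / 2\<close> for the values of \<open>f\<close> near
      \<open>K \<times> H\<close>, and \<open>e / 4\<close> for the mass missed by each of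
      \<open>K\<close> and \<open>H\<close>.\<close>
    fix e :: real assume e: "0 < e"
    then have e4: "0 < e / 4" by simp
    obtain K where K: "compact K" "measure \<mu> UNIV \<le> measure \<mu> K + e / 4"
      using radon_probs_inner_regular[OF \<mu>(1) _ e4, of UNIV] by auto
    obtain H where H: "compact H" "measure \<nu> UNIV \<le> measure \<nu> H + e / 4"
      using radon_probs_inner_regular[OF \<nu>(1) _ e4, of UNIV] by auto
    have one: "measure \<mu> UNIV = 1" "measure \<nu> UNIV = 1"
      using prob_space.prob_space[OF radon_probsD(1)[OF \<mu>(1)]] prob_space.prob_space[OF radon_probsD(1)[OF \<nu>(1)]]
        radon_probsD(4)[OF \<mu>(1)] radon_probsD(4)[OF \<nu>(1)] by simp_all
    have "L f \<le> e" if f: "f \<in> bcontfun" "\<forall>p. 0 \<le> f p \<and> f p \<le> 1" "\<forall>p\<in>K \<times> H. f p = 0" for f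
    proof -
      \<comment> \<open>By Wallace's theorem this open neighbourhood of \<open>K \<times> H\<close>
        contains an open rectangle around it, so cutoffs in the separate variables can be
        used.\<close>
      have "open {p. f p < e / 2}"
        using bcontfun_continuous[OF f(1)] by (intro open_Collect_less continuous_intros)
      then have "openin (prod_topology euclidean euclidean) {p. f p < e / 2}"
        by simp
      moreover have "K \<times> H \<subseteq> {p. f p < e / 2}" using f(3) e by auto
      ultimately obtain U V where UV: "open U" "open V" "K \<subseteq> U" "H \<subseteq> V" "U \<times> V \<subseteq> {p. f p < e / 2}"
        using Wallace_theorem_prod_topology[of euclidean K euclidean H] K(1) H(1)
        by (metis compactin_euclidean_iff open_openin)
      obtain \<phi> :: "'a \<Rightarrow> real" where \<phi>: "\<phi> \<in> bcontfun" "\<And>x. 0 \<le> \<phi> x" "\<And>x. \<phi> x \<le> 1"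
        "\<And>x. x \<in> K \<Longrightarrow> \<phi> x = 1" "\<And>x. x \<notin> U \<Longrightarrow> \<phi> x = 0"
        by (rule Urysohn_bcontfun[OF cr K(1) UV(1,3)], rule that)
      obtain \<psi> :: "'a \<Rightarrow> real" where \<psi>: "\<psi> \<in> bcontfun" "\<And>x. 0 \<le> \<psi> x" "\<And>x. \<psi> x \<le> 1"
        "\<And>x. x \<in> H \<Longrightarrow> \<psi> x = 1" "\<And>x. x \<notin> V \<Longrightarrow> \<psi> x = 0"
        by (rule Urysohn_bcontfun[OF cr H(1) UV(2,4)], rule that)
      have b\<phi>: "(\<lambda>p. \<phi> (fst p)) \<in> bcontfun" and b\<psi>: "(\<lambda>p. \<psi> (snd p)) \<in> bcontfun"
        by (rule bcontfun_compose[OF \<phi>(1) continuous_on_fst[OF continuous_on_id]],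
            rule bcontfun_compose[OF \<psi>(1) continuous_on_snd[OF continuous_on_id]])
      \<comment> \<open>On \<open>U \<times> V\<close> the first summand suffices; off it one cutoff
        vanishes, so the right-hand side is at least 1. Each remaining term depends on one
        coordinate only, and its integral is fixed by a marginal.\<close>
      have f_le: "f p \<le> e / 2 + (1 - \<phi> (fst p)) + (1 - \<psi> (snd p))" for p
      proof (cases "p \<in> U \<times> V")
        case True
        then have "f p < e / 2" using UV(5) by blast
        then show ?thesis using \<phi>(3)[of "fst p"] \<psi>(3)[of "snd p"] by simp
      next
        case False
        then have "\<phi> (fst p) = 0 \<or> \<psi> (snd p) = 0"
          using \<phi>(5)[of "fst p"] \<psi>(5)[of "snd p"] by (auto simp: mem_Times_iff)
        then show ?thesis
          using f(2)[rule_format, of p] \<phi>(3)[of "fst p"] \<psi>(3)[of "snd p"] e by auto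
      qed
      have ev: "\<forall>\<^sub>F i in G. (\<integral>p. f p \<partial>\<pi>s i) \<le> e / 2 + (1 - (\<integral>x. \<phi> x \<partial>\<mu>s i)) + (1 - (\<integral>x. \<psi> x \<partial>\<nu>s i))"
        using rd cpG
      proof eventually_elim
        case (elim i)
        interpret P: prob_space "\<pi>s i" using radon_probsD(1)[OF elim(1)] .
        have "(\<integral>p. f p \<partial>\<pi>s i) \<le> (\<integral>p. e / 2 + (1 - \<phi> (fst p)) + (1 - \<psi> (snd p)) \<partial>\<pi>s i)"
          using f_le by (intro integral_mono int[OF elim(1)] plus_cont minus_cont const_bcontfun f(1) b\<phi> b\<psi>) auto
        also have "\<dots> = e / 2 + (1 - (\<integral>p. \<phi> (fst p) \<partial>\<pi>s i)) + (1 - (\<integral>p. \<psi> (snd p) \<partial>\<pi>s i))"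
          using int[OF elim(1) b\<phi>] int[OF elim(1) b\<psi>] by (simp add: P.prob_space)
        finally show ?case
          using couplings_integral(1)[OF elim(2) \<phi>(1)] couplings_integral(2)[OF elim(2) \<psi>(1)] by simp
      qed
      have "((\<lambda>i. \<integral>x. \<phi> x \<partial>\<mu>s i) \<longlongrightarrow> (\<integral>x. \<phi> x \<partial>\<mu>)) G" "((\<lambda>i. \<integral>x. \<psi> x \<partial>\<nu>s i) \<longlongrightarrow> (\<integral>x. \<psi> x \<partial>\<nu>)) G"
        using \<mu>(2) \<nu>(2) \<phi>(1) \<psi>(1) G(1) unfolding weakly_converges_def by (auto intro: tendsto_mono)
      then have "((\<lambda>i. e / 2 + (1 - (\<integral>x. \<phi> x \<partial>\<mu>s i)) + (1 - (\<integral>x. \<psi> x \<partial>\<nu>s i))) \<longlongrightarrow>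
          e / 2 + (1 - (\<integral>x. \<phi> x \<partial>\<mu>)) + (1 - (\<integral>x. \<psi> x \<partial>\<nu>))) G"
        by (intro tendsto_intros)
      from tendsto_le[OF G(2) this L[OF f(1)] ev]
      have "L f \<le> e / 2 + (1 - (\<integral>x. \<phi> x \<partial>\<mu>)) + (1 - (\<integral>x. \<psi> x \<partial>\<nu>))" .
      moreover have "measure \<mu> K \<le> (\<integral>x. \<phi> x \<partial>\<mu>)"
        using integral_bcontfun_bounds(1)[OF radon_probsD(1,3)[OF \<mu>(1)] \<phi>(1) K(1) \<phi>(4) UV(1) \<phi>(5) \<phi>(2,3)] by simp
      moreover have "measure \<nu> H \<le> (\<integral>x. \<psi> x \<partial>\<nu>)"
        using integral_bcontfun_bounds(1)[OF radon_probsD(1,3)[OF \<nu>(1)] \<psi>(1) H(1) \<psi>(4) UV(2) \<psi>(5) \<psi>(2,3)] by simp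
      ultimately show ?thesis using K(2) H(2) one by simp
    qed
    then show "\<exists>K. compact K \<and>
      (\<forall>f\<in>bcontfun. (\<forall>x. 0 \<le> f x \<and> f x \<le> 1) \<longrightarrow> (\<forall>x\<in>K. f x = 0) \<longrightarrow> L f \<le> e)"
      using compact_Times[OF K(1) H(1)] by (intro exI[of _ "K \<times> H"]) blast
  qed
  have "weakly_converges \<pi>s representing_measure G"
    using L by (simp add: weakly_converges_def integral_representing_measure)
  then show thesis using that[OF G representing_measure_radon] by blast
qed

text \<open>A net eventually outside \<open>U\<close> along \<open>F\<close> would be so along the
  finer filter \<open>G\<close>, where it is eventually inside; this is impossible as
  \<open>G \<noteq> bot\<close>.\<close>

lemma weakly_converges_imp_net_limit_point:
  assumes "G \<le> F" "G \<noteq> bot" "\<pi> \<in> radon_probs" "weakly_converges \<pi>s \<pi> G"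
    "\<forall>\<^sub>F i in F. \<pi>s i \<in> radon_probs"
  shows "net_limit_point weak_topology \<pi>s F \<pi>"
proof -
  have "limitin weak_topology \<pi>s \<pi> G"
    using assms by (subst limitin_weak_topology_iff) (auto intro: filter_leD)
  then have "\<exists>\<^sub>F i in F. \<pi>s i \<in> U" if "openin weak_topology U" "\<pi> \<in> U" for U
    using that assms(2) filter_leD[OF assms(1), of "\<lambda>i. \<pi>s i \<notin> U"]
      eventually_frequently[of G "\<lambda>i. \<pi>s i \<in> U"]
    by (auto simp: limitin_def frequently_def)
  then show ?thesis
    using assms(3) by (simp add: net_limit_point_def topspace_weak_topology)
qed

section \<open>Lower semicontinuous integrands along nets\<close>

text \<open>Starting the count at 1 instead of 0 removes the extra 1 from the bound; this is why
  layer sums never exceed their argument.\<close>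

lemma sum_indicator_less_le:
  assumes "0 \<le> t"
  shows "(\<Sum>k=1..n. indicator {real k<..} t) \<le> (t :: real)"
proof (induction n)
  case (Suc n)
  show ?case
  proof (cases "real (Suc n) < t")
    case True
    have "(\<Sum>k=1..Suc n. indicator {real k<..} t) \<le> (\<Sum>k=1..Suc n. 1 :: real)"
      by (intro sum_mono) (auto simp: indicator_def)
    with True show ?thesis by simp
  qed (use Suc in simp)
qed (use assms in simp)

lemma sum_indicator_le_ge: "min (real n) t - 1 \<le> (\<Sum>k=1..n. indicator {real k..} t)"
proof (induction n)
  case (Suc n)
  show ?case
  proof (cases "real n \<le> t")
    case True
    have "real n = (\<Sum>k=1..n. 1)" by simp
    also have "\<dots> = (\<Sum>k=1..n. indicator {real k..} t)"
      using True by (intro sum.cong) auto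
    finally show ?thesis using True by (auto simp: indicator_def)
  qed (use Suc in auto)
qed simp

lemma ennreal_mult_sum:
  assumes "0 \<le> a" "\<And>k. k \<in> A \<Longrightarrow> 0 \<le> g k"
  shows "ennreal (a * (\<Sum>k\<in>A. g k)) = ennreal a * (\<Sum>k\<in>A. ennreal (g k))"
  using assms by (simp add: ennreal_mult sum_nonneg sum_ennreal)

lemma directed_set_finite_upper_bound:
  assumes I: "directed_set I le" and J: "finite J" "J \<subseteq> I"
  shows "\<exists>k\<in>I. \<forall>j\<in>J. le j k"
  using J
proof induction
  case empty
  then show ?case using I by (auto simp: directed_set_def)
next
  case (insert a J)
  then obtain k where k: "k \<in> I" "\<forall>j\<in>J. le j k" by auto
  obtain m where m: "m \<in> I" "le a m" "le k m"
    using I insert.prems k(1) unfolding directed_set_def by blast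
  have "le j m" if "j \<in> J" for j
    using I k m that insert.prems unfolding directed_set_def by (meson insert_subset subsetD transp_onD)
  with m show ?case by auto
qed

lemma net_filter_neq_bot: "directed_set I le \<Longrightarrow> net_filter I le \<noteq> bot"
  by (auto simp: trivial_limit_def eventually_net_filter directed_set_def reflp_on_def)

lemma eventually_net_filter_mem: "directed_set I le \<Longrightarrow> \<forall>\<^sub>F i in net_filter I le. i \<in> I"
  by (auto simp: eventually_net_filter directed_set_def)

text \<open>A lower Riemann sum of mesh \<open>1 / n\<close> on \<open>[0, n]\<close> for the layer-cake formula
  \<open>x = \<integral> t. indicator {t<..} x\<close>; it is \<open>0\<close> for \<open>n = 0\<close>.\<close>

definition layer_sum :: "nat \<Rightarrow> ennreal \<Rightarrow> ennreal" where
  "layer_sum n x = ennreal (1 / n) * (\<Sum>k=1..n * n. indicator {ennreal (real k / real n)<..} x)"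

lemma layer_sum_0 [simp]: "layer_sum 0 x = 0"
  by (simp add: layer_sum_def)

text \<open>After multiplication by \<open>n\<close> this counts positive integers below
  \<open>n * x\<close>; the value \<open>\<top>\<close> is trivial.\<close>

lemma layer_sum_le: "layer_sum n x \<le> x"
proof (cases "n = 0 \<or> x = \<top>")
  case False
  then obtain r where r: "x = ennreal r" "0 \<le> r" and n: "0 < n" by (cases x) auto
  have ind: "(indicator {ennreal (real k / real n)<..} x :: ennreal) = ennreal (indicator {real k<..} (r * n))" for k
    using r n by (auto simp: indicator_def ennreal_less_iff divide_less_eq)
  have "layer_sum n x = ennreal (1 / n * (\<Sum>k=1..n * n. indicator {real k<..} (r * n)))"
    unfolding layer_sum_def ind by (subst ennreal_mult_sum) auto
  also have "\<dots> \<le> ennreal (1 / n * (r * n))"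
    using r by (intro ennreal_leI mult_left_mono sum_indicator_less_le) auto
  also have "\<dots> = x" using r n by simp
  finally show ?thesis .
qed auto

text \<open>Once the grid reaches beyond a finite \<open>r\<close> below \<open>x\<close>, its sum
  misses at most \<open>1 / n\<close> of \<open>r\<close>. A lower bound on the
  \<open>liminf\<close> is what Fatou's lemma requires.\<close>

lemma le_liminf_layer_sum: "x \<le> liminf (\<lambda>n. layer_sum n x)"
  unfolding le_Liminf_iff
proof (intro allI impI)
  \<comment> \<open>The intermediate \<open>z\<close> is finite even for \<open>x = \<top>\<close>,
    and \<open>z < x\<close> lets closed half-lines at level \<open>r\<close> be dominated by the
    open ones in \<open>layer_sum\<close>.\<close>
  fix y assume "y < x"
  then obtain z where z: "y < z" "z < x" using dense by blast
  then obtain r where r: "z = ennreal r" "0 \<le> r" by (cases z) auto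
  obtain s where s: "y = ennreal s" "0 \<le> s" using z by (cases y) auto
  have "s < r" using z(1) r s by (simp add: ennreal_less_iff)
  then have "\<forall>\<^sub>F n in sequentially. s < r - 1 / real n"
    by real_asymp
  moreover have "\<forall>\<^sub>F n in sequentially. r \<le> real n"
    by real_asymp
  moreover have "\<forall>\<^sub>F n in sequentially. 0 < (n :: nat)"
    by real_asymp
  ultimately show "\<forall>\<^sub>F n in sequentially. y < layer_sum n x"
  proof eventually_elim
    case (elim n)
    have "r * n \<le> real (n * n)" using elim by (simp add: mult_right_mono)
    then have "s < 1 / n * (min (real (n * n)) (r * n) - 1)"
      using elim by (simp add: min_absorb2 field_simps)
    also have "\<dots> \<le> 1 / n * (\<Sum>k=1..n * n. indicator {real k..} (r * n))"
      by (intro mult_left_mono sum_indicator_le_ge) auto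
    finally have "y < ennreal (1 / n * (\<Sum>k=1..n * n. indicator {real k..} (r * n)))"
      using s by (simp add: ennreal_less_iff)
    also have "\<dots> = ennreal (1 / n) * (\<Sum>k=1..n * n. ennreal (indicator {real k..} (r * n)))"
      by (rule ennreal_mult_sum) auto
    also have "\<dots> \<le> layer_sum n x"
      unfolding layer_sum_def
    proof (intro mult_left_mono sum_mono)
      fix k
      have "ennreal (real k / real n) < x" if "real k \<le> r * n"
      proof -
        have "ennreal (real k / real n) \<le> z"
          using that r elim by (auto intro!: ennreal_leI simp: divide_le_eq)
        then show ?thesis using z(2) by simp
      qed
      then show "ennreal (indicator {real k..} (r * n)) \<le> indicator {ennreal (real k / real n)<..} x"
        by (auto simp: indicator_def)
    qed simp
    finally show ?case .
  qed
qed

lemma borel_measurable_layer_sum [measurable]: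
  "f \<in> borel_measurable M \<Longrightarrow> (\<lambda>x. layer_sum n (f x)) \<in> borel_measurable M"
  unfolding layer_sum_def by measurable

lemma nn_integral_layer_sum:
  assumes [measurable]: "f \<in> borel_measurable M"
  shows "(\<integral>\<^sup>+x. layer_sum n (f x) \<partial>M)
    = ennreal (1 / n) * (\<Sum>k=1..n * n. emeasure M {x \<in> space M. ennreal (real k / real n) < f x})"
proof -
  have "(\<integral>\<^sup>+x. indicator {ennreal (real k / real n)<..} (f x) \<partial>M)
      = emeasure M {x \<in> space M. ennreal (real k / real n) < f x}" for k
  proof -
    have "(\<integral>\<^sup>+x. indicator {ennreal (real k / real n)<..} (f x) \<partial>M)
        = (\<integral>\<^sup>+x. indicator {x \<in> space M. ennreal (real k / real n) < f x} x \<partial>M)"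
      by (rule nn_integral_cong) (auto simp: indicator_def)
    then show ?thesis by simp
  qed
  then show ?thesis
    unfolding layer_sum_def by (simp add: nn_integral_cmult nn_integral_sum)
qed

section \<open>The liminf inequality\<close>

text \<open>Compactness replaces monotone convergence, which can fail for uncountable nets. Each
  layer sum of the supremum is bounded by the liminf, and Fatou's lemma in \<open>n\<close>
  concludes. A general \<open>G\<close> allows the result to be used along finer filters.\<close>

lemma liminf_nn_integral_lower_semicontinuous:
  fixes c :: "'i \<Rightarrow> 'b::t2_space \<Rightarrow> ennreal"
  assumes cr: "completely_regular_space (euclidean :: 'b topology)"
    and I: "directed_set I le" and G: "G \<le> net_filter I le" "G \<noteq> bot"
    and \<pi>: "\<pi> \<in> radon_probs" "weakly_converges \<pi>s \<pi> G"
    and \<pi>s: "\<And>i. i \<in> I \<Longrightarrow> \<pi>s i \<in> radon_probs"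
    and mono: "monotone_on I le (\<le>) c" and lsc: "\<And>i. i \<in> I \<Longrightarrow> lower_semicontinuous (c i)"
  shows "(\<integral>\<^sup>+p. (SUP i\<in>I. c i p) \<partial>\<pi>) \<le> Liminf G (\<lambda>i. \<integral>\<^sup>+p. c i p \<partial>\<pi>s i)"
proof -
  define C where "C p = (SUP i\<in>I. c i p)" for p
  let ?R = "Liminf G (\<lambda>i. \<integral>\<^sup>+p. c i p \<partial>\<pi>s i)"
  interpret prob_space \<pi> using radon_probsD[OF \<pi>(1)] by simp
  note sets\<pi> = radon_probsD(3)[OF \<pi>(1)] and space\<pi> = radon_probsD(4)[OF \<pi>(1)]
  \<comment> \<open>The supremum has open level sets, hence is Borel measurable even for uncountable
    \<open>I\<close>.\<close>
  have Ceq: "{p. a < C p} = (\<Union>i\<in>I. {p. a < c i p})" for a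
    by (auto simp: C_def less_SUP_iff)
  have op: "open {p. a < c i p}" if "i \<in> I" for a i
    using lsc[OF that] by (simp add: lower_semicontinuous_def)
  have opC: "open {p. a < C p}" for a
    unfolding Ceq using op by blast
  have measC: "C \<in> borel_measurable \<pi>"
    using opC sets\<pi> space\<pi> by (intro borel_measurableI_greater) simp
  have "(\<integral>\<^sup>+p. layer_sum n (C p) \<partial>\<pi>) \<le> ?R" for n
  proof (cases "n = 0", simp, rule ennreal_le_epsilon)
    fix e :: real assume n: "n \<noteq> 0" and e: "0 < e"
    let ?N = "n * n"
    \<comment> \<open>There are \<open>n * n\<close> levels, each losing \<open>h\<close> with
      weight \<open>1 / n\<close>; the total loss is \<open>n * h = e\<close>.\<close>
    define h where "h = e / n"
    have h: "0 < h" using n e by (simp add: h_def)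
    define U where "U j k = {p. ennreal (real k / real n) < c j p}" for j and k :: nat
    define V where "V k = {p. ennreal (real k / real n) < C p}" for k :: nat
    have "\<exists>K J. compact K \<and> measure \<pi> (V k) \<le> measure \<pi> K + h \<and> finite J \<and> J \<subseteq> I \<and> K \<subseteq> (\<Union>j\<in>J. U j k)" for k
    proof -
      have "V k \<in> sets borel" unfolding V_def using opC by simp
      then obtain K where K: "compact K" "K \<subseteq> V k" "measure \<pi> (V k) \<le> measure \<pi> K + h"
        using radon_probs_inner_regular[OF \<pi>(1) _ h] by blast
      have "K \<subseteq> (\<Union>j\<in>I. U j k)" using K(2) unfolding V_def U_def Ceq .
      then obtain J where "J \<subseteq> I" "finite J" "K \<subseteq> (\<Union>j\<in>J. U j k)"
        using compactE_image[OF K(1), of I "\<lambda>j. U j k"] op unfolding U_def by metis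
      with K show ?thesis by blast
    qed
    then obtain K J where KJ: "\<And>k. compact (K k)" "\<And>k. measure \<pi> (V k) \<le> measure \<pi> (K k) + h"
      "\<And>k. finite (J k)" "\<And>k. J k \<subseteq> I" "\<And>k. K k \<subseteq> (\<Union>j\<in>J k. U j k)"
      by metis
    \<comment> \<open>Finitely many levels, each using finitely many indices, are dominated by one
      index because \<open>I\<close> is directed; the sets \<open>U m k\<close> then contain all the
      compact sets.\<close>
    have "\<exists>m\<in>I. \<forall>j\<in>(\<Union>k\<in>{1..?N}. J k). le j m"
      using KJ(3,4) by (intro directed_set_finite_upper_bound[OF I]) auto
    then obtain m where m: "m \<in> I" "\<And>k j. k \<in> {1..?N} \<Longrightarrow> j \<in> J k \<Longrightarrow> le j m" by blast
    have KU: "K k \<subseteq> U m k" if "k \<in> {1..?N}" for k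
    proof
      fix p assume "p \<in> K k"
      then obtain j where j: "j \<in> J k" "p \<in> U j k" using KJ(5) by blast
      then have "c j \<le> c m"
        using m(1) m(2)[OF that j(1)] KJ(4) by (intro monotone_onD[OF mono]) auto
      then show "p \<in> U m k" using j(2) by (auto simp: U_def le_fun_def intro: less_le_trans)
    qed
    have "\<exists>f :: 'b \<Rightarrow> real. f \<in> bcontfun \<and> (\<forall>x. 0 \<le> f x \<and> f x \<le> 1) \<and> (\<forall>x\<in>K k. f x = 1) \<and> (\<forall>x. x \<notin> U m k \<longrightarrow> f x = 0)"
      if k: "k \<in> {1..?N}" for k
    proof -
      have oU: "open (U m k)" using op m(1) by (simp add: U_def)
      obtain f :: "'b \<Rightarrow> real" where "f \<in> bcontfun" "\<And>x. 0 \<le> f x" "\<And>x. f x \<le> 1"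
        "\<And>x. x \<in> K k \<Longrightarrow> f x = 1" "\<And>x. x \<notin> U m k \<Longrightarrow> f x = 0"
        by (rule Urysohn_bcontfun[OF cr KJ(1) oU KU[OF k]], rule that)
      then show ?thesis by (intro exI[of _ f]) simp
    qed
    then obtain \<phi> where \<phi>: "\<And>k. k \<in> {1..?N} \<Longrightarrow> (\<phi> k :: 'b \<Rightarrow> real) \<in> bcontfun \<and> (\<forall>x. 0 \<le> \<phi> k x \<and> \<phi> k x \<le> 1)
        \<and> (\<forall>x\<in>K k. \<phi> k x = 1) \<and> (\<forall>x. x \<notin> U m k \<longrightarrow> \<phi> k x = 0)"
      by metis
    \<comment> \<open>A bounded continuous replacement for \<open>layer_sum n (c m)\<close>, lying
      below it and hence below every \<open>c i\<close> with \<open>le m i\<close>. Weak convergence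
      can be applied to it.\<close>
    define \<Phi> where "\<Phi> p = 1 / n * (\<Sum>k=1..?N. \<phi> k p)" for p
    have \<Phi>b: "\<Phi> \<in> bcontfun"
      unfolding \<Phi>_def using \<phi> by (intro bcontfun_scale bcontfun_sum) blast
    have \<Phi>0: "0 \<le> \<Phi> p" for p
      unfolding \<Phi>_def using \<phi> by (intro mult_nonneg_nonneg sum_nonneg) auto
    have \<Phi>c: "ennreal (\<Phi> p) \<le> c m p" for p
    proof -
      have "ennreal (\<Phi> p) = ennreal (1 / n) * (\<Sum>k=1..?N. ennreal (\<phi> k p))"
        unfolding \<Phi>_def using \<phi> by (intro ennreal_mult_sum) auto
      also have "\<dots> \<le> layer_sum n (c m p)"
        unfolding layer_sum_def
      proof (intro mult_left_mono sum_mono)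
        fix k assume k: "k \<in> {1..?N}"
        show "ennreal (\<phi> k p) \<le> indicator {ennreal (real k / real n)<..} (c m p)"
          using \<phi>[OF k] by (cases "p \<in> U m k") (auto simp: U_def)
      qed simp
      also have "\<dots> \<le> c m p" by (rule layer_sum_le)
      finally show ?thesis .
    qed
    have ev: "\<forall>\<^sub>F i in G. ennreal (\<integral>p. \<Phi> p \<partial>\<pi>s i) \<le> (\<integral>\<^sup>+p. c i p \<partial>\<pi>s i)"
    proof -
      have "\<forall>\<^sub>F i in net_filter I le. i \<in> I \<and> le m i"
        using eventually_net_filter_mem[OF I] m(1) by (auto simp: eventually_net_filter[OF I])
      then have "\<forall>\<^sub>F i in G. i \<in> I \<and> le m i" by (rule filter_leD[OF G(1)])
      then show ?thesis
      proof eventually_elim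
        case (elim i)
        have "ennreal (\<integral>p. \<Phi> p \<partial>\<pi>s i) = (\<integral>\<^sup>+p. ennreal (\<Phi> p) \<partial>\<pi>s i)"
          using integrable_bcontfun[OF radon_probsD(2,3)[OF \<pi>s] \<Phi>b, of i] elim \<Phi>0
          by (intro nn_integral_eq_integral[symmetric]) auto
        also have "\<dots> \<le> (\<integral>\<^sup>+p. c i p \<partial>\<pi>s i)"
        proof (rule nn_integral_mono)
          fix p
          have "c m \<le> c i" using elim m(1) by (intro monotone_onD[OF mono]) auto
          then show "ennreal (\<Phi> p) \<le> c i p" using \<Phi>c[of p] by (auto simp: le_fun_def intro: order_trans)
        qed
        finally show ?case .
      qed
    qed
    have "((\<lambda>i. \<integral>p. \<Phi> p \<partial>\<pi>s i) \<longlongrightarrow> (\<integral>p. \<Phi> p \<partial>\<pi>)) G"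
      using \<pi>(2) \<Phi>b by (simp add: weakly_converges_def)
    then have "((\<lambda>i. ennreal (\<integral>p. \<Phi> p \<partial>\<pi>s i)) \<longlongrightarrow> ennreal (\<integral>p. \<Phi> p \<partial>\<pi>)) G"
      by (rule tendsto_ennrealI)
    then have "ennreal (\<integral>p. \<Phi> p \<partial>\<pi>) = Liminf G (\<lambda>i. ennreal (\<integral>p. \<Phi> p \<partial>\<pi>s i))"
      using G(2) by (intro lim_imp_Liminf[symmetric]) auto
    also have "\<dots> \<le> ?R" by (rule Liminf_mono[OF ev])
    finally have \<Phi>R: "ennreal (\<integral>p. \<Phi> p \<partial>\<pi>) \<le> ?R" .
    have "(\<integral>p. \<Phi> p \<partial>\<pi>) = 1 / n * (\<Sum>k=1..?N. \<integral>p. \<phi> k p \<partial>\<pi>)"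
      unfolding \<Phi>_def using \<phi> integrable_bcontfun[OF finite_measure_axioms sets\<pi>]
      by (simp add: Bochner_Integration.integral_sum)
    also have "\<dots> \<ge> 1 / n * (\<Sum>k=1..?N. measure \<pi> (V k) - h)"
    proof (intro mult_left_mono sum_mono)
      fix k assume k: "k \<in> {1..?N}"
      have "open (U m k)" using op m(1) by (simp add: U_def)
      then have "measure \<pi> (K k) \<le> (\<integral>p. \<phi> k p \<partial>\<pi>)"
        using \<phi>[OF k] by (intro integral_bcontfun_bounds(1)[OF prob_space_axioms sets\<pi> _ KJ(1), of _ _ "U m k"]) auto
      then show "measure \<pi> (V k) - h \<le> (\<integral>p. \<phi> k p \<partial>\<pi>)" using KJ(2)[of k] by simp
    qed simp
    also have "1 / n * (\<Sum>k=1..?N. measure \<pi> (V k) - h) = 1 / n * (\<Sum>k=1..?N. measure \<pi> (V k)) - e"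
    proof -
      have "1 / n * (real ?N * h) = e" using n by (simp add: h_def)
      then show ?thesis by (simp add: sum_subtractf right_diff_distrib diff_divide_distrib)
    qed
    finally have le: "1 / n * (\<Sum>k=1..?N. measure \<pi> (V k)) \<le> (\<integral>p. \<Phi> p \<partial>\<pi>) + e" by simp
    have "(\<integral>\<^sup>+p. layer_sum n (C p) \<partial>\<pi>) = ennreal (1 / n) * (\<Sum>k=1..?N. emeasure \<pi> (V k))"
      using nn_integral_layer_sum[OF measC, of n] space\<pi> by (simp add: V_def)
    also have "\<dots> = ennreal (1 / n * (\<Sum>k=1..?N. measure \<pi> (V k)))"
      unfolding emeasure_eq_measure by (rule ennreal_mult_sum[symmetric]) auto
    also have "\<dots> \<le> ennreal ((\<integral>p. \<Phi> p \<partial>\<pi>) + e)" by (rule ennreal_leI[OF le])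
    also have "\<dots> = ennreal (\<integral>p. \<Phi> p \<partial>\<pi>) + ennreal e"
      using e \<Phi>0 by (intro ennreal_plus) (auto intro: integral_nonneg)
    also have "\<dots> \<le> ?R + ennreal e" by (intro add_mono \<Phi>R order_refl)
    finally show "(\<integral>\<^sup>+p. layer_sum n (C p) \<partial>\<pi>) \<le> ?R + ennreal e" .
  qed
  then have bound: "limsup (\<lambda>n. \<integral>\<^sup>+p. layer_sum n (C p) \<partial>\<pi>) \<le> ?R"
    by (intro Limsup_bounded) auto
  have "(\<integral>\<^sup>+p. C p \<partial>\<pi>) \<le> (\<integral>\<^sup>+p. liminf (\<lambda>n. layer_sum n (C p)) \<partial>\<pi>)"
    by (intro nn_integral_mono le_liminf_layer_sum)
  also have "\<dots> \<le> liminf (\<lambda>n. \<integral>\<^sup>+p. layer_sum n (C p) \<partial>\<pi>)"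
    using measC by (intro nn_integral_liminf) measurable
  also have "\<dots> \<le> limsup (\<lambda>n. \<integral>\<^sup>+p. layer_sum n (C p) \<partial>\<pi>)"
    by (intro Liminf_le_Limsup) simp
  also note bound
  finally show ?thesis by (simp add: C_def)
qed

section \<open>Convergence of the Wasserstein distances\<close>

text \<open>With its counterpart below, this moves strict inequalities across the square root,
  infinite values included, so that squared and unsquared costs can be exchanged.\<close>

lemma ennreal_sqrt_less_iff: "ennreal_sqrt a < x \<longleftrightarrow> a < x\<^sup>2"
proof (cases a; cases x)
  fix r s assume "a = ennreal r" "0 \<le> r" "x = ennreal s" "0 \<le> s"
  moreover have "sqrt r < s \<longleftrightarrow> r < s\<^sup>2" if "0 \<le> r" "0 \<le> s" for r s :: real
    using that by (metis real_sqrt_less_iff real_sqrt_unique)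
  ultimately show ?thesis
    by (simp add: ennreal_sqrt_def ennreal_less_iff ennreal_power)
qed (auto simp: ennreal_sqrt_def ennreal_power power2_eq_square ennreal_mult_less_top)

lemma less_ennreal_sqrt_iff: "a < ennreal_sqrt x \<longleftrightarrow> a\<^sup>2 < x"
proof (cases a; cases x)
  fix r s assume "a = ennreal r" "0 \<le> r" "x = ennreal s" "0 \<le> s"
  moreover have "r < sqrt s \<longleftrightarrow> r\<^sup>2 < s" if "0 \<le> r" "0 \<le> s" for r s :: real
    using that by (metis real_sqrt_less_iff real_sqrt_unique)
  ultimately show ?thesis
    by (simp add: ennreal_sqrt_def ennreal_less_iff ennreal_power)
qed (auto simp: ennreal_sqrt_def ennreal_power power2_eq_square ennreal_mult_less_top)

lemma ennreal_sqrt_mono: "x \<le> y \<Longrightarrow> ennreal_sqrt x \<le> ennreal_sqrt y"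
  by (meson less_ennreal_sqrt_iff less_le_trans linorder_not_le order.irrefl)

lemma wasserstein_mono:
  assumes "d \<le> d'"
  shows "wasserstein d \<mu> \<nu> \<le> wasserstein d' \<mu> \<nu>"
  unfolding wasserstein_def using assms
  by (intro ennreal_sqrt_mono INF_mono' nn_integral_mono) (auto simp: le_fun_def intro!: power_mono)

lemma wasserstein_monotone_on:
  "monotone_on I le (\<le>) ds \<Longrightarrow> monotone_on I le (\<le>) (\<lambda>i. wasserstein (ds i) \<mu> \<nu>)"
  by (intro monotone_onI wasserstein_mono) (auto dest: monotone_onD)

text \<open>The upper bound is monotonicity in the distance. For the lower bound, costs staying
  below the limit value would give cheap plans for all \<open>ds i\<close>; a limit point of these
  plans would, by the liminf inequality, be too cheap for \<open>d\<close>.\<close>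

lemma wasserstein_tendsto:
  fixes d :: "'a::t2_space \<Rightarrow> 'a \<Rightarrow> ennreal" and ds :: "'i \<Rightarrow> 'a \<Rightarrow> 'a \<Rightarrow> ennreal"
  assumes cr: "completely_regular_space (euclidean :: 'a topology)"
    and I: "directed_set I le"
    and \<mu>: "\<mu> \<in> radon_probs" and \<nu>: "\<nu> \<in> radon_probs"
    and mono: "monotone_on I le (\<le>) ds"
    and cont: "\<And>i. i \<in> I \<Longrightarrow> continuous_on UNIV (\<lambda>(x, y). ds i x y)"
    and lim: "\<And>x y. ((\<lambda>i. ds i x y) \<longlongrightarrow> d x y) (net_filter I le)"
  shows "((\<lambda>i. wasserstein (ds i) \<mu> \<nu>) \<longlongrightarrow> wasserstein d \<mu> \<nu>) (net_filter I le)"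
proof -
  let ?F = "net_filter I le"
  note F = net_filter_neq_bot[OF I]
    and cr2 = completely_regular_space_euclidean_prod[OF cr cr]
    and Wmono = wasserstein_monotone_on[OF mono]
  \<comment> \<open>A nondecreasing net stays below its limit.\<close>
  have ds_le: "ds i x y \<le> d x y" if i: "i \<in> I" for i x y
  proof (rule tendsto_lowerbound[OF lim _ F])
    show "\<forall>\<^sub>F j in ?F. ds i x y \<le> ds j x y"
      unfolding eventually_net_filter[OF I]
      using i monotone_onD[OF mono] by (intro bexI[of _ i]) (auto simp: le_fun_def)
  qed
  show "((\<lambda>i. wasserstein (ds i) \<mu> \<nu>) \<longlongrightarrow> wasserstein d \<mu> \<nu>) ?F"
  proof (rule order_tendstoI)
    fix u assume "wasserstein d \<mu> \<nu> < u"
    moreover have "wasserstein (ds i) \<mu> \<nu> \<le> wasserstein d \<mu> \<nu>" if "i \<in> I" for i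
      using ds_le[OF that] by (intro wasserstein_mono) (simp add: le_fun_def)
    ultimately show "\<forall>\<^sub>F i in ?F. wasserstein (ds i) \<mu> \<nu> < u"
      using eventually_net_filter_mem[OF I] by (auto elim!: eventually_mono intro: le_less_trans)
  next
    fix u assume u: "u < wasserstein d \<mu> \<nu>"
    have "\<exists>i\<in>I. u < wasserstein (ds i) \<mu> \<nu>"
    proof (rule ccontr)
      assume "\<not> ?thesis"
      then have small: "(INF \<pi>\<in>couplings \<mu> \<nu>. \<integral>\<^sup>+(x, y). (ds i x y)\<^sup>2 \<partial>\<pi>) \<le> u\<^sup>2" if "i \<in> I" for i
        using that by (auto simp: wasserstein_def less_ennreal_sqrt_iff not_less)
      have "u\<^sup>2 < (INF \<pi>\<in>couplings \<mu> \<nu>. \<integral>\<^sup>+(x, y). (d x y)\<^sup>2 \<partial>\<pi>)"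
        using u by (simp add: wasserstein_def less_ennreal_sqrt_iff)
      \<comment> \<open>The gap up to \<open>v\<close> permits nearly optimal plans, so minimisers
        need not exist.\<close>
      then obtain v where v: "u\<^sup>2 < v" "v < (INF \<pi>\<in>couplings \<mu> \<nu>. \<integral>\<^sup>+(x, y). (d x y)\<^sup>2 \<partial>\<pi>)"
        using dense by blast
      have "\<exists>\<pi>\<in>couplings \<mu> \<nu>. (\<integral>\<^sup>+(x, y). (ds i x y)\<^sup>2 \<partial>\<pi>) < v" if "i \<in> I" for i
        using le_less_trans[OF small[OF that] v(1)] by (simp add: INF_less_iff)
      then obtain \<rho> where \<rho>: "\<And>i. i \<in> I \<Longrightarrow> \<rho> i \<in> couplings \<mu> \<nu>"
        "\<And>i. i \<in> I \<Longrightarrow> (\<integral>\<^sup>+(x, y). (ds i x y)\<^sup>2 \<partial>\<rho> i) < v"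
        by metis
      have \<rho>cp: "\<forall>\<^sub>F i in ?F. \<rho> i \<in> couplings \<mu> \<nu>"
        using eventually_net_filter_mem[OF I] by eventually_elim (rule \<rho>(1))
      have \<rho>rd: "\<rho> i \<in> radon_probs" if "i \<in> I" for i
        using \<rho>(1)[OF that] by (simp add: couplings_def)
      have \<mu>c: "weakly_converges (\<lambda>_. \<mu>) \<mu> ?F" and \<nu>c: "weakly_converges (\<lambda>_. \<nu>) \<nu> ?F"
        by (simp_all add: weakly_converges_def)
      obtain G \<pi> where G: "G \<le> ?F" "G \<noteq> bot" and \<pi>: "\<pi> \<in> radon_probs" "weakly_converges \<rho> \<pi> G"
        by (rule couplings_cluster[OF cr F \<rho>cp \<mu> \<mu>c \<nu> \<nu>c])
      have "\<forall>\<^sub>F i in ?F. \<rho> i \<in> radon_probs"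
        using eventually_net_filter_mem[OF I] by eventually_elim (rule \<rho>rd)
      then have "net_limit_point weak_topology \<rho> ?F \<pi>"
        by (rule weakly_converges_imp_net_limit_point[OF G \<pi>])
      then have \<pi>cp: "\<pi> \<in> couplings \<mu> \<nu>"
        by (rule net_limit_point_couplings[OF cr \<rho>cp \<mu> \<mu>c \<nu> \<nu>c])
      define c where "c i p = (ds i (fst p) (snd p))\<^sup>2" for i p
      have "(\<integral>\<^sup>+p. (SUP i\<in>I. c i p) \<partial>\<pi>) \<le> Liminf G (\<lambda>i. \<integral>\<^sup>+p. c i p \<partial>\<rho> i)"
      proof (rule liminf_nn_integral_lower_semicontinuous[OF cr2 I G \<pi> \<rho>rd])
        show "monotone_on I le (\<le>) c"
        proof (intro monotone_onI le_funI)
          fix i j p assume "i \<in> I" "j \<in> I" "le i j"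
          then have "ds i \<le> ds j" by (rule monotone_onD[OF mono])
          then show "c i p \<le> c j p" unfolding c_def by (intro power_mono) (auto simp: le_fun_def)
        qed
        \<comment> \<open>The superlevel set of the square at \<open>a\<close> is that of the
          continuous \<open>ds i\<close> at \<open>ennreal_sqrt a\<close>.\<close>
        show "lower_semicontinuous (c i)" if "i \<in> I" for i
          unfolding lower_semicontinuous_def c_def ennreal_sqrt_less_iff[symmetric]
          using cont that by (intro allI open_Collect_less continuous_intros) (auto simp: case_prod_unfold)
      qed
      also have "\<dots> \<le> v"
      proof -
        have "\<forall>\<^sub>F i in G. i \<in> I"
          using eventually_net_filter_mem[OF I] by (rule filter_leD[OF G(1)])
        then have "\<forall>\<^sub>F i in G. (\<integral>\<^sup>+p. c i p \<partial>\<rho> i) \<le> v"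
          using \<rho>(2) by (auto elim!: eventually_mono simp: c_def case_prod_unfold less_imp_le)
        then have "Limsup G (\<lambda>i. \<integral>\<^sup>+p. c i p \<partial>\<rho> i) \<le> v" by (rule Limsup_bounded)
        then show ?thesis using Liminf_le_Limsup[OF G(2)] by (rule order_trans[rotated])
      qed
      finally have cv: "(\<integral>\<^sup>+p. (SUP i\<in>I. c i p) \<partial>\<pi>) \<le> v" .
      \<comment> \<open>Every \<open>a\<close> below the limit's square is exceeded by some
        \<open>c i\<close>, since \<open>ds i\<close> eventually exceeds
        \<open>ennreal_sqrt a\<close>.\<close>
      have dc: "(d (fst p) (snd p))\<^sup>2 \<le> (SUP i\<in>I. c i p)" for p
      proof (rule dense_le)
        fix a assume "a < (d (fst p) (snd p))\<^sup>2"
        then have "ennreal_sqrt a < d (fst p) (snd p)" by (simp add: ennreal_sqrt_less_iff)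
        then have "\<forall>\<^sub>F i in ?F. ennreal_sqrt a < ds i (fst p) (snd p)"
          by (rule order_tendstoD(1)[OF lim])
        then have "\<forall>\<^sub>F i in ?F. i \<in> I \<and> a < c i p"
          using eventually_net_filter_mem[OF I]
          by eventually_elim (simp add: c_def ennreal_sqrt_less_iff)
        then obtain i where "i \<in> I" "a < c i p" using eventually_happens'[OF F] by blast
        then show "a \<le> (SUP i\<in>I. c i p)" by (intro SUP_upper2[of i]) auto
      qed
      have "(\<integral>\<^sup>+(x, y). (d x y)\<^sup>2 \<partial>\<pi>) \<le> v"
        unfolding case_prod_unfold by (rule order_trans[OF nn_integral_mono[OF dc] cv])
      moreover have "(INF \<pi>\<in>couplings \<mu> \<nu>. \<integral>\<^sup>+(x, y). (d x y)\<^sup>2 \<partial>\<pi>) \<le> (\<integral>\<^sup>+(x, y). (d x y)\<^sup>2 \<partial>\<pi>)"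
        by (rule INF_lower[OF \<pi>cp])
      ultimately show False using v(2) by simp
    qed
    then obtain i where i: "i \<in> I" "u < wasserstein (ds i) \<mu> \<nu>" by blast
    show "\<forall>\<^sub>F j in ?F. u < wasserstein (ds j) \<mu> \<nu>"
      unfolding eventually_net_filter[OF I]
      using i monotone_onD[OF Wmono] by (intro bexI[of _ i]) (auto intro: less_le_trans)
  qed
qed

section \<open>Limit points, lower semicontinuity and convergence of costs\<close>

theorem theorem5p1:
  fixes d :: "'a::t2_space \<Rightarrow> 'a \<Rightarrow> ennreal"
    and I :: "'i set" and le :: "'i \<Rightarrow> 'i \<Rightarrow> bool"
    and \<mu>s \<nu>s :: "'i \<Rightarrow> 'a measure" and \<mu> \<nu> :: "'a measure"
    and \<pi>s :: "'i \<Rightarrow> ('a \<times> 'a) measure"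
  assumes "extended_metric_topological_space d"
    and "directed_set I le"
    and "\<And>i. i \<in> I \<Longrightarrow> \<mu>s i \<in> radon_probs" and "\<And>i. i \<in> I \<Longrightarrow> \<nu>s i \<in> radon_probs"
    and "\<mu> \<in> radon_probs" and "\<nu> \<in> radon_probs"
    and "weakly_converges \<mu>s \<mu> (net_filter I le)"
    and "weakly_converges \<nu>s \<nu> (net_filter I le)"
    and "\<And>i. i \<in> I \<Longrightarrow> \<pi>s i \<in> couplings (\<mu>s i) (\<nu>s i)"
  shows
    "((\<exists>\<pi>. net_limit_point weak_topology \<pi>s (net_filter I le) \<pi>) \<and>
      (\<forall>\<pi>. net_limit_point weak_topology \<pi>s (net_filter I le) \<pi> \<longrightarrow> \<pi> \<in> couplings \<mu> \<nu>)) \<and>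
     (\<forall>\<pi> (c :: 'i \<Rightarrow> 'a \<times> 'a \<Rightarrow> ennreal).
        \<pi> \<in> radon_probs \<and> weakly_converges \<pi>s \<pi> (net_filter I le) \<and>
        monotone_on I le (\<le>) c \<and> (\<forall>i\<in>I. lower_semicontinuous (c i)) \<longrightarrow>
        Liminf (net_filter I le) (\<lambda>i. \<integral>\<^sup>+p. c i p \<partial>\<pi>s i) \<ge> (\<integral>\<^sup>+p. (SUP i\<in>I. c i p) \<partial>\<pi>)) \<and>
     ((\<forall>i\<in>I. \<mu>s i = \<mu> \<and> \<nu>s i = \<nu>) \<longrightarrow>
      (\<forall>ds :: 'i \<Rightarrow> 'a \<Rightarrow> 'a \<Rightarrow> ennreal.
        monotone_on I le (\<le>) ds \<and>
        (\<forall>i\<in>I. extended_distance (ds i) \<and> continuous_on UNIV (\<lambda>(x, y). ds i x y)) \<and>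
        (\<forall>x y. ((\<lambda>i. ds i x y) \<longlongrightarrow> d x y) (net_filter I le)) \<longrightarrow>
        monotone_on I le (\<le>) (\<lambda>i. wasserstein (ds i) \<mu> \<nu>) \<and>
        ((\<lambda>i. wasserstein (ds i) \<mu> \<nu>) \<longlongrightarrow> wasserstein d \<mu> \<nu>) (net_filter I le)))"
proof -
  let ?F = "net_filter I le"
  note I = assms(2)
  \<comment> \<open>The topology is generated by the continuous functions in \<open>Lip_b d\<close>,
    so it is completely regular.\<close>
  have cr: "completely_regular_space (euclidean :: 'a topology)"
    using assms(1) unfolding extended_metric_topological_space_def
    by (intro completely_regular_space_generated[of "Lip_b d"]) (auto simp: Lip_b_def bcontfun_continuous)
  note cr2 = completely_regular_space_euclidean_prod[OF cr cr]
  have F: "?F \<noteq> bot" by (rule net_filter_neq_bot[OF I])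
  have radon: "\<pi>s i \<in> radon_probs" if "i \<in> I" for i
    using assms(9)[OF that] by (simp add: couplings_def)
  have cp: "\<forall>\<^sub>F i in ?F. \<pi>s i \<in> couplings (\<mu>s i) (\<nu>s i)"
    using eventually_net_filter_mem[OF I] by eventually_elim (rule assms(9))
  have rd: "\<forall>\<^sub>F i in ?F. \<pi>s i \<in> radon_probs"
    using eventually_net_filter_mem[OF I] by eventually_elim (rule radon)
  have a: "\<exists>\<pi>. net_limit_point weak_topology \<pi>s ?F \<pi>"
  proof -
    obtain G \<pi> where "G \<le> ?F" "G \<noteq> bot" "\<pi> \<in> radon_probs" "weakly_converges \<pi>s \<pi> G"
      by (rule couplings_cluster[OF cr F cp assms(5,7,6,8)])
    from weakly_converges_imp_net_limit_point[OF this rd] show ?thesis by blast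
  qed
  have a': "\<pi> \<in> couplings \<mu> \<nu>" if "net_limit_point weak_topology \<pi>s ?F \<pi>" for \<pi>
    by (rule net_limit_point_couplings[OF cr cp assms(5,7,6,8) that])
  have b: "(\<integral>\<^sup>+p. (SUP i\<in>I. c i p) \<partial>\<pi>) \<le> Liminf ?F (\<lambda>i. \<integral>\<^sup>+p. c i p \<partial>\<pi>s i)"
    if "\<pi> \<in> radon_probs" "weakly_converges \<pi>s \<pi> ?F" "monotone_on I le (\<le>) c"
      "\<forall>i\<in>I. lower_semicontinuous (c i)" for \<pi> and c :: "'i \<Rightarrow> 'a \<times> 'a \<Rightarrow> ennreal"
    using that(4) by (intro liminf_nn_integral_lower_semicontinuous[OF cr2 I order_refl F that(1,2) radon that(3)]) auto
  have c: "((\<lambda>i. wasserstein (ds i) \<mu> \<nu>) \<longlongrightarrow> wasserstein d \<mu> \<nu>) ?F"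
    if "monotone_on I le (\<le>) ds"
      "\<forall>i\<in>I. extended_distance (ds i) \<and> continuous_on UNIV (\<lambda>(x, y). ds i x y)"
      "\<forall>x y. ((\<lambda>i. ds i x y) \<longlongrightarrow> d x y) ?F" for ds
    using that by (intro wasserstein_tendsto[OF cr I assms(5,6)]) simp_all
  show ?thesis
    by (intro conjI allI impI; (elim conjE)?) (rule a a' b wasserstein_monotone_on c; assumption)+
qed

end
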